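(* Let $\omega\in\widetilde L_N^1(\mathbb S_1)$ be the weight of a cyclic Pólya ensemble on $\mathrm U(N)$, and let $$P_j(z_1)=\sum_{k=0}^{j}\frac{1}{(j-k)!\,k!}\frac{(-z_1)^k}{\mathcal S\omega(k)}\quad(0\le j\le N-1),\qquad P_{-1}=0,\qquad Q_j(z_2)=z_2\partial_{z_2}^jz_2^{j-1}\omega(z_2).$$ Then the correlation kernel $K_N(z_1,z_2)=\sum_{j=0}^{N-1}P_j(z_1)Q_j(z_2)$ of the eigenvalues can be written as $$K_N(z_1,z_2)=P_{N-1}(z_1)Q_{N-1}(z_2)+i\int_0^{2\pi}\frac{d\varphi}{2\pi}\,\varphi\,P_{N-2}(z_1e^{i\varphi})Q_{N-1}(z_2e^{i\varphi})+\frac{1-(z_1z_2^{-1})^{N-1}}{1-z_1z_2^{-1}} .$$ If moreover $\omega$ is $N$-times differentiable with $\partial^j\omega\in L^1(\mathbb S_1)$ for $j=0,\ldots,N$, then $$K_N(z_1,z_2)=i\int_0^{2\pi}\frac{d\varphi}{2\pi}\,\varphi\,P_{N-1}(z_1e^{i\varphi})Q_N(z_2e^{i\varphi})+\frac{1-(z_1z_2^{-1})^{N}}{1-z_1z_2^{-1}},$$ where $Q_N(z')=(z'\partial_{z'}+N-1)Q_{N-1}(z')$.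
   Context: $\mathbb S_1=\{z\in\mathbb C: |z|=1\}$ carries the normalised Haar measure $\frac{dz'}{2\pi i z'}$ (i.e. $\frac{d\theta}{2\pi}$ for $z'=e^{i\theta}$); functions on $\mathbb S_1$ are identified when equal almost everywhere (identities involving $Q_{N-1}(z_2)$ hold for almost every $z_2$). Here $z_1,z_2\in\mathbb S_1$, and the ratios $\frac{1-r^n}{1-r}$ mean $\sum_{k=0}^{n-1}r^k$. A star denotes complex conjugation, and $z'\partial_{z'}=-i\,\frac{d}{d\theta}$. The operator $z\partial_z^jz^{j-1}$ first multiplies by $z^{j-1}$, then differentiates $j$ times, then multiplies by $z$; equivalently it is $\prod_{m=0}^{j-1}(z\partial_z+m)$. $\Delta_N(z)=\prod_{1\le a<b\le N}(z_b-z_a)$. For $w\in L^1(\mathbb S_1)$ and $s\in\mathbb Z$, $\mathcal Sw(s)=\int_{\mathbb S_1}\frac{dz'}{2\pi i z'}{z'}^{s}w(z')$. $L_N^1(\mathbb S_1)=\{w\in L^1(\mathbb S_1): [w(z)]^*=z^{N-1}w(z)\}$. $\widetilde L_N^1(\mathbb S_1)$ is the set of $w\in L_N^1(\mathbb S_1)$ that are $(N-1)$-times differentiable with $\partial^jw\in L^1(\mathbb S_1)$ for $j=0,\ldots,N-1$. Here "$n$-times differentiable" means, for $n\ge1$, $(n-1)$-times continuously differentiable with absolutely continuous $(n-1)$-th derivative, so that the $n$-th derivative need only exist almost everywhere. The cyclic Pólya ensemble on $\mathrm U(N)$ with weight $\omega\in\widetilde L_N^1(\mathbb S_1)$ is the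 unitarily invariant random matrix ensemble whose eigenvalues have joint density, with respect to $\prod_{j}\frac{dz_j}{2\pi i z_j}$, $$p_N(z)=\frac{1}{N!\prod_{j=0}^{N-1}[j!\,\mathcal S\omega(j)]}\,\Delta_N(z)\det[(-z_a\partial_{z_a})^{b-1}\omega(z_a)]_{a,b=1,\ldots,N}\ge0 ,$$ where it is part of the definition that $\prod_{j=0}^{N-1}\mathcal S\omega(j)>0$. Its eigenvalues form a determinantal point process with kernel $K_N$: the $k$-point function $\frac{N!}{(N-k)!}\int p_N(z)\prod_{j=k+1}^N\frac{dz_j}{2\pi i z_j}$ equals $\det[K_N(z_a,z_b)]_{a,b=1,\ldots,k}$. *)

theory Defs
  imports "HOL-Analysis.Analysis" "Jordan_Normal_Form.Determinant"
begin

text \<open>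
  Functions on the unit circle are represented by functions on the complex plane; only their
  values on the circle matter. The normalised Haar measure is represented on the angle \<open>\<theta>\<close> of the
  point \<open>cis \<theta>\<close>. It is built from \<open>lebesgue\<close> rather than \<open>lborel\<close> so that derivatives that
  exist only almost everywhere are measurable.
\<close>

definition haar_angle :: "real measure" where
  "haar_angle = uniform_measure lebesgue {0..<2 * pi}"

definition L1_circle :: "(complex \<Rightarrow> complex) set" where
  "L1_circle = {f. integrable haar_angle (\<lambda>\<theta>. f (cis \<theta>))}"

definition mellin :: "(complex \<Rightarrow> complex) \<Rightarrow> int \<Rightarrow> complex" where
  "mellin w s = (LINT \<theta>|haar_angle. cis \<theta> powi s * w (cis \<theta>))"


text \<open>
  Differentiation along the circle: \<open>euler\<close> is \<open>z \<partial>\<^sub>z = - \<i> d/d\<theta>\<close> at \<open>z = e\<^sup>i\<^sup>\<theta>\<close>, and \<open>cderiv\<close> is \<open>\<partial>\<^sub>z\<close>.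
  Their values are meaningful at the points where \<open>cdifferentiable\<close> holds.
\<close>

definition cdifferentiable :: "(complex \<Rightarrow> complex) \<Rightarrow> complex \<Rightarrow> bool" where
  "cdifferentiable f z \<longleftrightarrow> (\<lambda>t. f (z * cis t)) differentiable (at 0)"

definition euler :: "(complex \<Rightarrow> complex) \<Rightarrow> complex \<Rightarrow> complex" where
  "euler f z = - \<i> * vector_derivative (\<lambda>t. f (z * cis t)) (at 0)"

definition cderiv :: "(complex \<Rightarrow> complex) \<Rightarrow> complex \<Rightarrow> complex" where
  "cderiv f z = euler f z / z"

definition abs_continuous_circle :: "(complex \<Rightarrow> complex) \<Rightarrow> bool" where
  "abs_continuous_circle f \<longleftrightarrow>
     (\<forall>\<epsilon>>0. \<exists>\<delta>>0. \<forall>(n::nat) (u::nat \<Rightarrow> real) (v::nat \<Rightarrow> real).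
        (\<forall>i<n. 0 \<le> u i \<and> u i \<le> v i \<and> v i \<le> 2 * pi) \<and>
        disjoint_family_on (\<lambda>i. {u i<..<v i}) {..<n} \<and>
        (\<Sum>i<n. v i - u i) < \<delta>
        \<longrightarrow> (\<Sum>i<n. norm (f (cis (v i)) - f (cis (u i)))) < \<epsilon>)"

definition times_differentiable :: "nat \<Rightarrow> (complex \<Rightarrow> complex) \<Rightarrow> bool" where
  "times_differentiable n f \<longleftrightarrow>
     (n \<ge> 1 \<longrightarrow>
       (\<forall>j<n - 1. \<forall>z\<in>sphere 0 1. cdifferentiable ((cderiv ^^ j) f) z) \<and>
       continuous_on (sphere 0 1) ((cderiv ^^ (n - 1)) f) \<and>
       abs_continuous_circle ((cderiv ^^ (n - 1)) f))"

text \<open>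
  The \<open>j\<close>-th derivative belongs to \<open>L\<^sup>1\<close>. Since \<open>cderiv\<close> is a total function, its existence almost
  everywhere is stated explicitly; where the previous derivative is absolutely continuous this is
  automatic by Lebesgue's differentiation theorem.
\<close>

definition deriv_in_L1 :: "nat \<Rightarrow> (complex \<Rightarrow> complex) \<Rightarrow> bool" where
  "deriv_in_L1 j f \<longleftrightarrow>
     (j \<ge> 1 \<longrightarrow> (AE \<theta> in haar_angle. cdifferentiable ((cderiv ^^ (j - 1)) f) (cis \<theta>))) \<and>
     (cderiv ^^ j) f \<in> L1_circle"

definition L1_sym :: "nat \<Rightarrow> (complex \<Rightarrow> complex) set" where
  "L1_sym N = {w \<in> L1_circle.
     AE \<theta> in haar_angle. cnj (w (cis \<theta>)) = cis \<theta> ^ (N - 1) * w (cis \<theta>)}"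

definition L1_sym_diff :: "nat \<Rightarrow> (complex \<Rightarrow> complex) set" where
  "L1_sym_diff N = {w \<in> L1_sym N.
     times_differentiable (N - 1) w \<and> (\<forall>j\<le>N - 1. deriv_in_L1 j w)}"


text \<open>The eigenvalues are indexed by \<open>0, \<dots>, N - 1\<close>.\<close>

definition vandermonde :: "nat \<Rightarrow> (nat \<Rightarrow> complex) \<Rightarrow> complex" where
  "vandermonde N z = (\<Prod>b<N. \<Prod>a<b. z b - z a)"

definition polya_density :: "nat \<Rightarrow> (complex \<Rightarrow> complex) \<Rightarrow> (nat \<Rightarrow> complex) \<Rightarrow> complex" where
  "polya_density N \<omega> z =
     1 / (fact N * (\<Prod>j<N. fact j * mellin \<omega> (int j))) * vandermonde N z *
     Determinant.det (Matrix.mat N N (\<lambda>(a, b). ((\<lambda>f u. - euler f u) ^^ b) \<omega> (z a)))"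

definition cyclic_polya_weight :: "nat \<Rightarrow> (complex \<Rightarrow> complex) \<Rightarrow> bool" where
  "cyclic_polya_weight N \<omega> \<longleftrightarrow>
     \<omega> \<in> L1_sym_diff N \<and>
     (\<Prod>j<N. mellin \<omega> (int j)) \<in> \<real> \<and> Re (\<Prod>j<N. mellin \<omega> (int j)) > 0 \<and>
     (AE \<theta> in PiM {..<N} (\<lambda>_. haar_angle). polya_density N \<omega> (\<lambda>i. cis (\<theta> i)) \<in> \<real>\<^sub>\<ge>\<^sub>0)"

definition k_point_function ::
  "nat \<Rightarrow> ((nat \<Rightarrow> complex) \<Rightarrow> complex) \<Rightarrow> nat \<Rightarrow> (nat \<Rightarrow> complex) \<Rightarrow> complex" where
  "k_point_function N p k z =
     fact N / fact (N - k) *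
     (LINT \<tau>|PiM {k..<N} (\<lambda>_. haar_angle). p (\<lambda>i. if i < k then z i else cis (\<tau> i)))"

definition correlation_kernel ::
  "nat \<Rightarrow> ((nat \<Rightarrow> complex) \<Rightarrow> complex) \<Rightarrow> (complex \<Rightarrow> complex \<Rightarrow> complex) \<Rightarrow> bool" where
  "correlation_kernel N p K \<longleftrightarrow>
     (\<forall>k\<in>{1..N}. AE \<theta> in PiM {..<k} (\<lambda>_. haar_angle).
        k_point_function N p k (\<lambda>i. cis (\<theta> i)) =
        Determinant.det (Matrix.mat k k (\<lambda>(a, b). K (cis (\<theta> a)) (cis (\<theta> b)))))"


text \<open>The index of \<open>polya_P\<close> is an integer so that \<open>j = - 1\<close> gives the empty sum.\<close>

definition polya_P :: "(complex \<Rightarrow> complex) \<Rightarrow> int \<Rightarrow> complex \<Rightarrow> complex" where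
  "polya_P \<omega> j z =
     (\<Sum>k<nat (j + 1). 1 / (fact (nat j - k) * fact k) * ((- z) ^ k / mellin \<omega> (int k)))"

definition polya_Q :: "(complex \<Rightarrow> complex) \<Rightarrow> nat \<Rightarrow> complex \<Rightarrow> complex" where
  "polya_Q \<omega> j z = z * (cderiv ^^ j) (\<lambda>u. u powi (int j - 1) * \<omega> u) z"

definition polya_kernel :: "nat \<Rightarrow> (complex \<Rightarrow> complex) \<Rightarrow> complex \<Rightarrow> complex \<Rightarrow> complex" where
  "polya_kernel N \<omega> z1 z2 = (\<Sum>j<N. polya_P \<omega> (int j) z1 * polya_Q \<omega> j z2)"

end

theory Submission
  imports Defs "HOL-Probability.Infinite_Product_Measure"
begin

text \<open>
  Write \<open>z = e\<^sup>i\<^sup>t\<close>, so that the weight becomes a \<open>2\<pi>\<close>-periodic function and \<open>z\<partial>\<close>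
  becomes \<open>- \<i> d/dt\<close>. Integration by parts multiplies the \<open>k\<close>-th Fourier coefficient by \<open>- k\<close>, so
  \<open>Q\<^sub>j = (z\<partial> + j - 1) \<dots> (z\<partial>) \<omega>\<close> has coefficients \<open>(0 - k) \<dots> (j - 1 - k) \<S>\<omega>(k)\<close>, and the
  functions \<open>P\<^sub>i\<close>, \<open>Q\<^sub>j\<close> are biorthonormal by the alternating binomial sum. Since \<open>P\<^sub>j\<close> and \<open>Q\<^sub>j\<close> arise
  from \<open>z\<^sup>k\<close> and \<open>(- z\<partial>)\<^sup>b \<omega>\<close> by triangular transformations, the density equals
  \<open>det [K\<^sub>N(z\<^sub>a, z\<^sub>b)] / N!\<close>, and the points can be integrated out one by one.

  The recurrences \<open>z\<partial> P\<^sub>j = j P\<^sub>j - P\<^sub>j\<^sub>-\<^sub>1\<close> and \<open>z\<partial> Q\<^sub>j = Q\<^sub>j\<^sub>+\<^sub>1 - j Q\<^sub>j\<close> make the derivative of \<open>K\<^sub>n\<close>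
  along simultaneous rotations telescope to \<open>P\<^sub>n\<^sub>-\<^sub>1 Q\<^sub>n\<close>; integrating it against \<open>\<phi>\<close> by parts gives both
  formulas, for \<open>n = N - 1\<close> and \<open>n = N\<close>. The last derivative exists only almost everywhere, so the
  fundamental theorem of calculus is needed for absolutely continuous functions.
\<close>

subsection \<open>Absolutely continuous functions\<close>

text \<open>The weight \<phi> / (2 pi) is a sawtooth. Its jump at the end of the period recovers the
  value of the kernel at the given pair of points, and its constant slope produces the mean over
  rotations, which is the geometric sum.

  \<open>polya_Q\<close> of index N - 1 already spends all N - 1 derivatives. It cannot be
  differentiated again, so in the first formula its summand stands apart and the by-parts argument
  is run on the other N - 1 summands only. With one more derivative it covers all N.

  Iterated derivatives are total functions here, with uncontrolled values where a derivative fails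
  to exist. Every identity between them therefore needs to know where it holds. One explicit null
  set B is carried through the whole development; it matters only at the highest order, and
  disappears as soon as one derivative is given up. Existence almost everywhere of the last
  derivative is part of \<open>deriv_in_L1\<close>, so the fundamental theorem can take it as a
  hypothesis and be proved directly for the gauge integral.\<close>

definition ac_on :: "real \<Rightarrow> real \<Rightarrow> (real \<Rightarrow> 'a::real_normed_vector) \<Rightarrow> bool" where
  "ac_on a b f \<longleftrightarrow>
     (\<forall>\<epsilon>>0. \<exists>\<delta>>0. \<forall>(n::nat) (u::nat \<Rightarrow> real) (v::nat \<Rightarrow> real).
        (\<forall>i<n. a \<le> u i \<and> u i \<le> v i \<and> v i \<le> b) \<and>
        disjoint_family_on (\<lambda>i. {u i<..<v i}) {..<n} \<and>
        (\<Sum>i<n. v i - u i) < \<delta>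
        \<longrightarrow> (\<Sum>i<n. norm (f (v i) - f (u i))) < \<epsilon>)"

text \<open>A division of an interval is a set of tagged pieces, not a sequence, so families over
  any finite index set are wanted: tagged pieces in the fundamental theorem, the one element of
  \<open>unit\<close> for continuity.\<close>

lemma ac_onD:
  fixes f :: "real \<Rightarrow> 'a::real_normed_vector"
  assumes "ac_on a b f" "\<epsilon> > 0"
  shows "\<exists>\<delta>>0. \<forall>(I :: 'i set) u v. finite I \<and> (\<forall>i\<in>I. a \<le> u i \<and> u i \<le> v i \<and> v i \<le> b) \<and>
       disjoint_family_on (\<lambda>i. {u i<..<v i}) I \<and> (\<Sum>i\<in>I. v i - u i) < \<delta> \<longrightarrow>
       (\<Sum>i\<in>I. norm (f (v i) - f (u i))) < \<epsilon>"
proof -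
  obtain \<delta> where \<delta>: "\<delta> > 0"
    "\<And>(n::nat) (u::nat \<Rightarrow> real) (v::nat \<Rightarrow> real).
        (\<forall>i<n. a \<le> u i \<and> u i \<le> v i \<and> v i \<le> b) \<and>
        disjoint_family_on (\<lambda>i. {u i<..<v i}) {..<n} \<and>
        (\<Sum>i<n. v i - u i) < \<delta>
        \<longrightarrow> (\<Sum>i<n. norm (f (v i) - f (u i))) < \<epsilon>"
    using assms unfolding ac_on_def by meson
  show ?thesis
  proof (rule exI[of _ \<delta>], intro conjI allI impI; (elim conjE)?)
    show "\<delta> > 0" by fact
    fix I :: "'i set" and u v
    assume I: "finite I" "\<forall>i\<in>I. a \<le> u i \<and> u i \<le> v i \<and> v i \<le> b"
      "disjoint_family_on (\<lambda>i. {u i<..<v i}) I" "(\<Sum>i\<in>I. v i - u i) < \<delta>"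
    obtain h where h: "bij_betw h {..<card I} I"
      using I(1) by (metis atLeast0LessThan ex_bij_betw_nat_finite)
    have inj: "inj_on h {..<card I}" and im: "h ` {..<card I} = I"
      using h by (auto simp: bij_betw_def)
    have "(\<Sum>i<card I. norm (f ((v \<circ> h) i) - f ((u \<circ> h) i))) < \<epsilon>"
    proof (rule \<delta>(2)[rule_format], intro conjI allI impI)
      show "disjoint_family_on (\<lambda>i. {(u \<circ> h) i<..<(v \<circ> h) i}) {..<card I}"
        using I(3) inj im unfolding disjoint_family_on_def inj_on_def by (metis comp_apply imageI)
      show "(\<Sum>i<card I. (v \<circ> h) i - (u \<circ> h) i) < \<delta>"
        using I(4) sum.reindex_bij_betw[OF h, of "\<lambda>i. v i - u i"] by simp
    qed (use I(2) im in auto)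
    then show "(\<Sum>i\<in>I. norm (f (v i) - f (u i))) < \<epsilon>"
      using sum.reindex_bij_betw[OF h, of "\<lambda>i. norm (f (v i) - f (u i))"] by simp
  qed
qed

text \<open>Tags in the null set are confined to an open set of small measure, where absolute
  continuity controls the increments; no covering theorem is needed.\<close>

theorem fundamental_theorem_of_calculus_ac:
  fixes f :: "real \<Rightarrow> 'a::euclidean_space"
  assumes ab: "a \<le> b" and ac: "ac_on a b f" and B: "negligible B"
    and deriv: "\<And>x. x \<in> {a..b} - B \<Longrightarrow> (f has_vector_derivative f' x) (at x within {a..b})"
  shows "(f' has_integral (f b - f a)) {a..b}"
proof -
  \<comment> \<open>\<open>f'\<close> is arbitrary on \<open>B\<close>; the value 0 removes the tags
    in \<open>B\<close> from the Riemann sum and leaves the integral unchanged.\<close>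
  define g where "g x = (if x \<in> B then 0 else f' x)" for x
  have "(g has_integral (f b - f a)) {a..b}"
    unfolding has_integral_real
  proof (intro allI impI)
    fix e :: real assume e: "e > 0"
    obtain \<delta> where \<delta>': "\<delta> > 0"
      "\<forall>(I :: (real \<times> real set) set) u v. finite I \<and> (\<forall>i\<in>I. a \<le> u i \<and> u i \<le> v i \<and> v i \<le> b) \<and>
       disjoint_family_on (\<lambda>i. {u i<..<v i}) I \<and> (\<Sum>i\<in>I. v i - u i) < \<delta> \<longrightarrow>
       (\<Sum>i\<in>I. norm (f (v i) - f (u i))) < e / 2"
      using ac_onD[where 'i = "real \<times> real set", OF ac half_gt_zero[OF e]] by (elim exE conjE) (rule that)
    note \<delta> = \<delta>'(1) \<delta>'(2)[THEN spec, THEN spec, THEN spec]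
    have Bn: "B \<in> null_sets lebesgue" using B by (simp add: negligible_iff_null_sets)
    obtain U where U: "open U" "B \<subseteq> U" "emeasure lebesgue (U - B) < ennreal \<delta>"
      by (rule sets_lebesgue_outer_open[OF null_setsD2[OF Bn] \<delta>(1)])
    have Um: "emeasure lebesgue U < ennreal \<delta>"
      using U Bn emeasure_Diff_null_set[OF Bn, of U] by simp
    \<comment> \<open>The summand 1 keeps the denominator positive when \<open>a = b\<close> and
      makes \<open>c * (b - a)\<close> strictly smaller than \<open>e / 2\<close>.\<close>
    define c where "c = e / (2 * (b - a) + 1)"
    have c: "c > 0" "c * (b - a) < e / 2"
      using e ab by (auto simp: c_def field_simps)
    have "\<exists>d>0. \<forall>y\<in>{a..b}. \<bar>y - x\<bar> < d \<longrightarrow> norm (f y - f x - (y - x) *\<^sub>R g x) \<le> c * \<bar>y - x\<bar>"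
      if "x \<in> {a..b} - B" for x
    proof -
      have "\<forall>e>0. \<exists>d>0. \<forall>y\<in>{a..b}. norm (y - x) < d \<longrightarrow>
          norm (f y - f x - (y - x) *\<^sub>R f' x) \<le> e * norm (y - x)"
        using deriv[OF that] unfolding has_vector_derivative_def has_derivative_within_alt by blast
      then show ?thesis using c(1) that by (simp add: g_def)
    qed
    then obtain d where d: "\<And>x. x \<in> {a..b} - B \<Longrightarrow> d x > 0"
      "\<And>x y. x \<in> {a..b} - B \<Longrightarrow> y \<in> {a..b} \<Longrightarrow> \<bar>y - x\<bar> < d x \<Longrightarrow>
         norm (f y - f x - (y - x) *\<^sub>R g x) \<le> c * \<bar>y - x\<bar>"
      by metis
    \<comment> \<open>A piece tagged in \<open>B\<close> is forced into \<open>U\<close>; a piece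
      tagged elsewhere in the interval is short enough for the derivative estimate. The ball of
      radius 1 only completes the gauge.\<close>
    define \<gamma> where "\<gamma> x = (if x \<in> B then U else if x \<in> {a..b} then ball x (d x) else ball x 1)" for x
    have G: "gauge \<gamma>"
      using U d(1) by (auto simp: gauge_def \<gamma>_def)
    have F: "norm ((\<Sum>(x, k)\<in>\<D>. measure lborel k *\<^sub>R g x) - (f b - f a)) < e"
      if D: "\<D> tagged_division_of {a..b}" and fine: "\<gamma> fine \<D>" for \<D>
    proof -
      note Dd = tagged_division_ofD[OF D]
      have k: "\<exists>u v. k = {u..v} \<and> u \<le> x \<and> x \<le> v \<and> a \<le> u \<and> v \<le> b \<and> Inf k = u \<and> Sup k = v
          \<and> measure lborel k = v - u \<and> k \<subseteq> \<gamma> x"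
        if xk: "(x, k) \<in> \<D>" for x k
      proof -
        obtain u v where uv: "k = cbox u v" using Dd(4)[OF xk] by blast
        moreover have "x \<in> k" "k \<subseteq> {a..b}" using Dd(2,3)[OF xk] by auto
        ultimately show ?thesis using fineD[OF fine xk] by auto
      qed
      let ?\<Delta> = "\<lambda>(x, k). f (Sup k) - f (Inf k)"
      let ?h = "\<lambda>(x, k). measure lborel k *\<^sub>R g x - (f (Sup k) - f (Inf k))"
      define D1 where "D1 = {p \<in> \<D>. fst p \<in> B}"
      define D2 where "D2 = {p \<in> \<D>. fst p \<notin> B}"
      have fin: "finite D1" "finite D2" and un: "\<D> = D1 \<union> D2" "D1 \<inter> D2 = {}"
        using Dd(1) by (auto simp: D1_def D2_def)
      have "(\<Sum>p\<in>\<D>. ?\<Delta> p) = f b - f a"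
        using additive_tagged_division_1[OF ab D, of f] by simp
      then have "(\<Sum>(x, k)\<in>\<D>. measure lborel k *\<^sub>R g x) - (f b - f a) = (\<Sum>p\<in>\<D>. ?h p)"
        by (simp add: case_prod_unfold sum_subtractf)
      also have "\<dots> = (\<Sum>p\<in>D1. ?h p) + (\<Sum>p\<in>D2. ?h p)"
        using un fin by (simp add: sum.union_disjoint)
      also have "norm \<dots> \<le> (\<Sum>p\<in>D1. norm (?h p)) + (\<Sum>p\<in>D2. norm (?h p))"
        by (intro norm_triangle_le add_mono norm_sum)
      also have "(\<Sum>p\<in>D2. norm (?h p)) \<le> (\<Sum>p\<in>D2. c * measure lborel (snd p))"
      proof (rule sum_mono)
        fix p assume p: "p \<in> D2"
        obtain x k' where xk: "p = (x, k')" by force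
        then have xD: "(x, k') \<in> \<D>" and xB: "x \<notin> B" using p by (auto simp: D2_def)
        obtain u v where uv: "k' = {u..v}" "u \<le> x" "x \<le> v" "a \<le> u" "v \<le> b" "Inf k' = u" "Sup k' = v"
          "measure lborel k' = v - u" "k' \<subseteq> \<gamma> x"
          using k[OF xD] by blast
        have xab: "x \<in> {a..b} - B" using uv xB by auto
        have sub: "{u..v} \<subseteq> ball x (d x)" using uv xB xab by (auto simp: \<gamma>_def)
        have "u \<in> ball x (d x)" "v \<in> ball x (d x)" using uv(2,3) by (auto intro!: subsetD[OF sub] simp del: mem_ball)
        then have du: "\<bar>u - x\<bar> < d x" "\<bar>v - x\<bar> < d x" by (auto simp: dist_real_def)
        have 1: "norm (f u - f x - (u - x) *\<^sub>R g x) \<le> c * \<bar>u - x\<bar>"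
          by (rule d(2)[OF xab _ du(1)]) (use uv in auto)
        have 2: "norm (f v - f x - (v - x) *\<^sub>R g x) \<le> c * \<bar>v - x\<bar>"
          by (rule d(2)[OF xab _ du(2)]) (use uv in auto)
        \<comment> \<open>Both end points are compared with the tag, which lies between them, so the
          two errors add up to \<open>c\<close> times the length of the piece.\<close>
        have "norm (?h p) = norm ((f u - f x - (u - x) *\<^sub>R g x) - (f v - f x - (v - x) *\<^sub>R g x))"
          using xk uv by (simp add: algebra_simps)
        also have "\<dots> \<le> c * \<bar>u - x\<bar> + c * \<bar>v - x\<bar>"
          by (rule order_trans[OF norm_triangle_ineq4 add_mono[OF 1 2]])
        also have "\<dots> = c * measure lborel k'" using uv by (simp add: algebra_simps)
        finally show "norm (?h p) \<le> c * measure lborel (snd p)" using xk by simp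
      qed
      also have "(\<Sum>p\<in>D2. c * measure lborel (snd p)) \<le> (\<Sum>p\<in>\<D>. c * measure lborel (snd p))"
        using c(1) Dd(1) by (intro sum_mono2) (auto simp: D2_def)
      also have "\<dots> = c * (b - a)"
        using additive_content_tagged_division[of \<D> a b] D ab
        by (simp add: case_prod_unfold flip: sum_distrib_left)
      also have "(\<Sum>p\<in>D1. norm (?h p)) = (\<Sum>p\<in>D1. norm (f (Sup (snd p)) - f (Inf (snd p))))"
        by (intro sum.cong refl) (auto simp: D1_def g_def norm_minus_commute)
      also have "\<dots> < e / 2"
      proof (rule \<delta>(2)[rule_format], intro conjI ballI; (elim conjE)?)
        have D1k: "\<exists>u v. snd p = {u..v} \<and> a \<le> u \<and> u \<le> v \<and> v \<le> b \<and> Inf (snd p) = u \<and> Sup (snd p) = v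
          \<and> snd p \<subseteq> U" if "p \<in> D1" for p
          using k[of "fst p" "snd p"] that by (fastforce simp: D1_def \<gamma>_def)
        have "a \<le> Inf (snd p) \<and> Inf (snd p) \<le> Sup (snd p) \<and> Sup (snd p) \<le> b" if "p \<in> D1" for p
          using D1k[OF that] by auto
        then show "a \<le> Inf (snd p)" "Inf (snd p) \<le> Sup (snd p)" "Sup (snd p) \<le> b" if "p \<in> D1" for p
          using that by auto
        show disj: "disjoint_family_on (\<lambda>p. {Inf (snd p)<..<Sup (snd p)}) D1"
          unfolding disjoint_family_on_def
        proof (intro ballI impI)
          fix p p' assume pp: "p \<in> D1" "p' \<in> D1" "p \<noteq> p'"
          then have "interior (snd p) \<inter> interior (snd p') = {}"
            using Dd(5)[of "fst p" "snd p" "fst p'" "snd p'"] by (auto simp: D1_def prod_eq_iff)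
          moreover have "interior (snd q) = {Inf (snd q)<..<Sup (snd q)}" if "q \<in> D1" for q
            using D1k[OF that] interior_atLeastAtMost_real by metis
          ultimately show "{Inf (snd p)<..<Sup (snd p)} \<inter> {Inf (snd p')<..<Sup (snd p')} = {}"
            using pp by auto
        qed
        \<comment> \<open>Pieces inside \<open>U\<close> with disjoint interiors have total length
          at most the measure of \<open>U\<close>, which is below \<delta>.\<close>
        have "ennreal (\<Sum>p\<in>D1. Sup (snd p) - Inf (snd p))
            = (\<Sum>p\<in>D1. emeasure lebesgue {Inf (snd p)<..<Sup (snd p)})"
          using D1k by (subst sum_ennreal[symmetric]) (fastforce intro!: sum.cong)+
        also have "\<dots> = emeasure lebesgue (\<Union>p\<in>D1. {Inf (snd p)<..<Sup (snd p)})"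
          by (rule sum_emeasure) (use disj fin in auto)
        also have "\<dots> \<le> emeasure lebesgue U"
          using D1k U(1) by (intro emeasure_mono) (fastforce simp: subset_eq)+
        also have "\<dots> < ennreal \<delta>" by fact
        finally show "(\<Sum>p\<in>D1. Sup (snd p) - Inf (snd p)) < \<delta>"
          by (metis ennreal_leI leD leI)
      qed (use fin in auto)
      finally show ?thesis using c(2) by linarith
    qed
    show "\<exists>\<gamma>. gauge \<gamma> \<and> (\<forall>\<D>. \<D> tagged_division_of {a..b} \<and> \<gamma> fine \<D> \<longrightarrow>
        norm ((\<Sum>(x, k)\<in>\<D>. measure lborel k *\<^sub>R g x) - (f b - f a)) < e)"
      by (intro exI[of _ \<gamma>] conjI allI impI G) (elim conjE, rule F)
  qed
  then show ?thesis
    by (rule has_integral_spike[OF B, rotated]) (auto simp: g_def)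
qed

section \<open>Closure properties of absolute continuity\<close>

lemma ac_onI:
  fixes f :: "real \<Rightarrow> 'a::real_normed_vector"
  assumes "\<And>\<epsilon>. \<epsilon> > 0 \<Longrightarrow> \<exists>\<delta>>0. \<forall>(n::nat) u v. (\<forall>i\<in>{..<n}. a \<le> u i \<and> u i \<le> v i \<and> v i \<le> b) \<longrightarrow>
       disjoint_family_on (\<lambda>i. {u i<..<v i}) {..<n} \<longrightarrow> (\<Sum>i<n. v i - u i) < \<delta> \<longrightarrow>
       (\<Sum>i<n. norm (f (v i) - f (u i))) < \<epsilon>"
  shows "ac_on a b f"
  using assms unfolding ac_on_def Ball_def lessThan_iff imp_conjL by simp

lemma ac_on_subset:
  assumes "ac_on a b f" "a \<le> c" "d \<le> b"
  shows "ac_on c d f"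
  using assms unfolding ac_on_def by (meson order_trans)

lemma ac_on_const: "ac_on a b (\<lambda>_. c)"
  unfolding ac_on_def by (auto intro: exI[of _ 1])

lemma ac_on_lipschitz:
  fixes f :: "real \<Rightarrow> 'a::real_normed_vector"
  assumes "C-lipschitz_on {a..b} f"
  shows "ac_on a b f"
proof (rule ac_onI, intro exI conjI allI impI)
  fix \<epsilon> :: real assume \<epsilon>: "\<epsilon> > 0"
  have C: "C \<ge> 0" using assms by (rule lipschitz_on_nonneg)
  show "\<epsilon> / (C + 1) > 0" using \<epsilon> C by auto
  fix n :: nat and u v :: "nat \<Rightarrow> real"
  assume uv: "\<forall>i\<in>{..<n}. a \<le> u i \<and> u i \<le> v i \<and> v i \<le> b" and s: "(\<Sum>i<n. v i - u i) < \<epsilon> / (C + 1)"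
  have "(\<Sum>i<n. norm (f (v i) - f (u i))) \<le> (\<Sum>i<n. C * (v i - u i))"
  proof (rule sum_mono)
    fix i assume "i \<in> {..<n}"
    then have "u i \<in> {a..b}" "v i \<in> {a..b}" "u i \<le> v i" using uv by force+
    then show "norm (f (v i) - f (u i)) \<le> C * (v i - u i)"
      using lipschitz_onD[OF assms, of "v i" "u i"] by (simp add: dist_norm)
  qed
  also have "\<dots> \<le> (C + 1) * (\<Sum>i<n. v i - u i)"
    unfolding sum_distrib_left using uv C by (intro sum_mono mult_right_mono) auto
  also have "\<dots> < \<epsilon>" using s C by (simp add: field_simps)
  finally show "(\<Sum>i<n. norm (f (v i) - f (u i))) < \<epsilon>" .
qed

text \<open>A domination criterion for both operations: sums take \<open>C = 1\<close>, products a
  bound on both factors.\<close>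

lemma ac_on_combine:
  fixes f :: "real \<Rightarrow> 'a::real_normed_vector" and g :: "real \<Rightarrow> 'b::real_normed_vector"
    and h :: "real \<Rightarrow> 'c::real_normed_vector"
  assumes f: "ac_on a b f" and g: "ac_on a b g" and C: "C > 0"
    and le: "\<And>x y. x \<in> {a..b} \<Longrightarrow> y \<in> {a..b} \<Longrightarrow>
      norm (h y - h x) \<le> C * (norm (f y - f x) + norm (g y - g x))"
  shows "ac_on a b h"
proof (rule ac_onI)
  fix \<epsilon> :: real assume \<epsilon>: "\<epsilon> > 0"
  then have \<epsilon>': "\<epsilon> / (2 * C) > 0" using C by simp
  obtain \<delta>1 where \<delta>1': "\<delta>1 > 0"
    "\<forall>(I :: nat set) u v. finite I \<and> (\<forall>i\<in>I. a \<le> u i \<and> u i \<le> v i \<and> v i \<le> b) \<and>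
       disjoint_family_on (\<lambda>i. {u i<..<v i}) I \<and> (\<Sum>i\<in>I. v i - u i) < \<delta>1 \<longrightarrow>
       (\<Sum>i\<in>I. norm (f (v i) - f (u i))) < \<epsilon> / (2 * C)"
    using ac_onD[where 'i = nat, OF f \<epsilon>'] by (elim exE conjE) (rule that)
    note \<delta>1 = \<delta>1'(1) \<delta>1'(2)[THEN spec, THEN spec, THEN spec]
  obtain \<delta>2 where \<delta>2': "\<delta>2 > 0"
    "\<forall>(I :: nat set) u v. finite I \<and> (\<forall>i\<in>I. a \<le> u i \<and> u i \<le> v i \<and> v i \<le> b) \<and>
       disjoint_family_on (\<lambda>i. {u i<..<v i}) I \<and> (\<Sum>i\<in>I. v i - u i) < \<delta>2 \<longrightarrow>
       (\<Sum>i\<in>I. norm (g (v i) - g (u i))) < \<epsilon> / (2 * C)"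
    using ac_onD[where 'i = nat, OF g \<epsilon>'] by (elim exE conjE) (rule that)
    note \<delta>2 = \<delta>2'(1) \<delta>2'(2)[THEN spec, THEN spec, THEN spec]
  show "\<exists>\<delta>>0. \<forall>(n::nat) u v. (\<forall>i\<in>{..<n}. a \<le> u i \<and> u i \<le> v i \<and> v i \<le> b) \<longrightarrow>
       disjoint_family_on (\<lambda>i. {u i<..<v i}) {..<n} \<longrightarrow> (\<Sum>i<n. v i - u i) < \<delta> \<longrightarrow>
       (\<Sum>i<n. norm (h (v i) - h (u i))) < \<epsilon>"
  proof (rule exI[of _ "min \<delta>1 \<delta>2"], intro conjI allI impI)
    fix n :: nat and u v :: "nat \<Rightarrow> real"
    assume uv: "\<forall>i\<in>{..<n}. a \<le> u i \<and> u i \<le> v i \<and> v i \<le> b"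
      and dis: "disjoint_family_on (\<lambda>i. {u i<..<v i}) {..<n}"
      and s: "(\<Sum>i<n. v i - u i) < min \<delta>1 \<delta>2"
    have "(\<Sum>i<n. norm (h (v i) - h (u i))) \<le>
        (\<Sum>i<n. C * (norm (f (v i) - f (u i)) + norm (g (v i) - g (u i))))"
      using uv by (intro sum_mono le) force+
    also have "\<dots> = C * ((\<Sum>i<n. norm (f (v i) - f (u i))) + (\<Sum>i<n. norm (g (v i) - g (u i))))"
      by (simp add: sum_distrib_left sum.distrib distrib_left)
    also have "\<dots> < C * (\<epsilon> / (2 * C) + \<epsilon> / (2 * C))"
      using \<delta>1(2)[of "{..<n}" u v] \<delta>2(2)[of "{..<n}" u v] uv dis s C
      by (intro mult_strict_left_mono add_strict_mono) auto
    also have "\<dots> = \<epsilon>" using C by (simp add: field_simps)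
    finally show "(\<Sum>i<n. norm (h (v i) - h (u i))) < \<epsilon>" .
  qed (use \<delta>1 \<delta>2 in auto)
qed

lemma ac_on_imp_continuous_on:
  fixes f :: "real \<Rightarrow> 'a::real_normed_vector"
  assumes "ac_on a b f"
  shows "continuous_on {a..b} f"
  unfolding continuous_on_iff
proof (intro ballI allI impI)
  fix x and e :: real assume x: "x \<in> {a..b}" and e: "e > 0"
  obtain \<delta> where \<delta>': "\<delta> > 0"
    "\<forall>(I :: unit set) u v. finite I \<and> (\<forall>i\<in>I. a \<le> u i \<and> u i \<le> v i \<and> v i \<le> b) \<and>
       disjoint_family_on (\<lambda>i. {u i<..<v i}) I \<and> (\<Sum>i\<in>I. v i - u i) < \<delta> \<longrightarrow>
       (\<Sum>i\<in>I. norm (f (v i) - f (u i))) < e"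
    using ac_onD[where 'i = unit, OF assms e] by (elim exE conjE) (rule that)
    note \<delta> = \<delta>'(1) \<delta>'(2)[THEN spec, THEN spec, THEN spec]
  have "dist (f y) (f x) < e" if y: "y \<in> {a..b}" "dist y x < \<delta>" for y
    using \<delta>(2)[of "{()}" "\<lambda>_. min x y" "\<lambda>_. max x y"] x y
    by (cases "x \<le> y") (auto simp: disjoint_family_on_def dist_norm norm_minus_commute)
  then show "\<exists>d>0. \<forall>y\<in>{a..b}. dist y x < d \<longrightarrow> dist (f y) (f x) < e"
    using \<delta>(1) by blast
qed

lemma ac_on_add:
  assumes "ac_on a b f" "ac_on a b g"
  shows "ac_on a b (\<lambda>x. f x + g x)"
  by (rule ac_on_combine[OF assms, of 1]) (auto simp: add_diff_add norm_triangle_ineq)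

lemma ac_on_mult:
  fixes f g :: "real \<Rightarrow> 'a::real_normed_algebra"
  assumes f: "ac_on a b f" and g: "ac_on a b g"
  shows "ac_on a b (\<lambda>x. f x * g x)"
proof -
  have "bounded (f ` {a..b})" "bounded (g ` {a..b})"
    using f g by (auto intro!: compact_imp_bounded compact_continuous_image ac_on_imp_continuous_on)
  then obtain F G where F: "\<And>x. x \<in> {a..b} \<Longrightarrow> norm (f x) \<le> F" and G: "\<And>x. x \<in> {a..b} \<Longrightarrow> norm (g x) \<le> G"
    unfolding bounded_iff by (metis imageI)
  show ?thesis
  proof (rule ac_on_combine[OF f g, of "max 1 (max F G)"])
    fix x y assume xy: "x \<in> {a..b}" "y \<in> {a..b}"
    let ?C = "max 1 (max F G)"
    have "norm (f y * g y - f x * g x) = norm ((f y - f x) * g y + f x * (g y - g x))"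
      by (simp add: algebra_simps)
    also have "\<dots> \<le> norm (f y - f x) * norm (g y) + norm (f x) * norm (g y - g x)"
      by (intro norm_triangle_le add_mono norm_mult_ineq)
    also have "\<dots> \<le> norm (f y - f x) * ?C + ?C * norm (g y - g x)"
      using F[OF xy(1)] G[OF xy(2)] by (intro add_mono mult_mono) auto
    finally show "norm (f y * g y - f x * g x) \<le> ?C * (norm (f y - f x) + norm (g y - g x))"
      by (simp add: algebra_simps)
  qed auto
qed

text \<open>An interval may straddle \<open>b\<close>. Clipping by \<open>min b\<close> and by
  \<open>max b\<close> gives one admissible family on each side, and the two increments add up to
  the original one; an interval wholly on the other side is clipped to a point.\<close>

lemma ac_on_concat:
  fixes f :: "real \<Rightarrow> 'a::real_normed_vector"
  assumes f: "ac_on a b f" and g: "ac_on b c f" and ab: "a \<le> b" "b \<le> c"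
  shows "ac_on a c f"
proof (rule ac_onI)
  fix \<epsilon> :: real assume \<epsilon>: "\<epsilon> > 0"
  obtain \<delta>1 where \<delta>1': "\<delta>1 > 0"
    "\<forall>(I :: nat set) u v. finite I \<and> (\<forall>i\<in>I. a \<le> u i \<and> u i \<le> v i \<and> v i \<le> b) \<and>
       disjoint_family_on (\<lambda>i. {u i<..<v i}) I \<and> (\<Sum>i\<in>I. v i - u i) < \<delta>1 \<longrightarrow>
       (\<Sum>i\<in>I. norm (f (v i) - f (u i))) < \<epsilon> / 2"
    using ac_onD[where 'i = nat, OF f half_gt_zero[OF \<epsilon>]] by (elim exE conjE) (rule that)
    note \<delta>1 = \<delta>1'(1) \<delta>1'(2)[THEN spec, THEN spec, THEN spec]
  obtain \<delta>2 where \<delta>2': "\<delta>2 > 0"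
    "\<forall>(I :: nat set) u v. finite I \<and> (\<forall>i\<in>I. b \<le> u i \<and> u i \<le> v i \<and> v i \<le> c) \<and>
       disjoint_family_on (\<lambda>i. {u i<..<v i}) I \<and> (\<Sum>i\<in>I. v i - u i) < \<delta>2 \<longrightarrow>
       (\<Sum>i\<in>I. norm (f (v i) - f (u i))) < \<epsilon> / 2"
    using ac_onD[where 'i = nat, OF g half_gt_zero[OF \<epsilon>]] by (elim exE conjE) (rule that)
    note \<delta>2 = \<delta>2'(1) \<delta>2'(2)[THEN spec, THEN spec, THEN spec]
  show "\<exists>\<delta>>0. \<forall>(n::nat) u v. (\<forall>i\<in>{..<n}. a \<le> u i \<and> u i \<le> v i \<and> v i \<le> c) \<longrightarrow>
       disjoint_family_on (\<lambda>i. {u i<..<v i}) {..<n} \<longrightarrow> (\<Sum>i<n. v i - u i) < \<delta> \<longrightarrow>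
       (\<Sum>i<n. norm (f (v i) - f (u i))) < \<epsilon>"
  proof (rule exI[of _ "min \<delta>1 \<delta>2"], intro conjI allI impI)
    fix n :: nat and u v :: "nat \<Rightarrow> real"
    assume uv: "\<forall>i\<in>{..<n}. a \<le> u i \<and> u i \<le> v i \<and> v i \<le> c"
      and dis: "disjoint_family_on (\<lambda>i. {u i<..<v i}) {..<n}"
      and s: "(\<Sum>i<n. v i - u i) < min \<delta>1 \<delta>2"
    have dis1: "disjoint_family_on (\<lambda>i. {min b (u i)<..<min b (v i)}) {..<n}"
      and dis2: "disjoint_family_on (\<lambda>i. {max b (u i)<..<max b (v i)}) {..<n}"
      by (rule disjoint_family_on_bisimulation[OF dis]; fastforce)+
    have s1: "(\<Sum>i<n. min b (v i) - min b (u i)) < \<delta>1"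
      by (rule le_less_trans[OF sum_mono[of "{..<n}" _ "\<lambda>i. v i - u i"]]) (use uv s in force)+
    have s2: "(\<Sum>i<n. max b (v i) - max b (u i)) < \<delta>2"
      by (rule le_less_trans[OF sum_mono[of "{..<n}" _ "\<lambda>i. v i - u i"]]) (use uv s in force)+
    have mm: "a \<le> min b (u i) \<and> min b (u i) \<le> min b (v i) \<and> min b (v i) \<le> b"
      "b \<le> max b (u i) \<and> max b (u i) \<le> max b (v i) \<and> max b (v i) \<le> c" if "i \<in> {..<n}" for i
      using bspec[OF uv that] ab by auto
    have "norm (f (v i) - f (u i)) \<le> norm (f (min b (v i)) - f (min b (u i)))
        + norm (f (max b (v i)) - f (max b (u i)))" for i
    proof -
      have "f (v i) - f (u i) = (f (min b (v i)) - f (min b (u i))) + (f (max b (v i)) - f (max b (u i)))"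
        by (auto simp: min_def max_def)
      then show ?thesis by (metis norm_triangle_ineq)
    qed
    then have "(\<Sum>i<n. norm (f (v i) - f (u i))) \<le> (\<Sum>i<n. norm (f (min b (v i)) - f (min b (u i))))
        + (\<Sum>i<n. norm (f (max b (v i)) - f (max b (u i))))"
      unfolding sum.distrib[symmetric] by (intro sum_mono) auto
    also have "\<dots> < \<epsilon> / 2 + \<epsilon> / 2"
    proof (rule add_strict_mono)
      show "(\<Sum>i<n. norm (f (min b (v i)) - f (min b (u i)))) < \<epsilon> / 2"
        using \<delta>1(2)[of "{..<n}" "\<lambda>i. min b (u i)" "\<lambda>i. min b (v i)"] mm(1) dis1 s1 by blast
      show "(\<Sum>i<n. norm (f (max b (v i)) - f (max b (u i)))) < \<epsilon> / 2"
        using \<delta>2(2)[of "{..<n}" "\<lambda>i. max b (u i)" "\<lambda>i. max b (v i)"] mm(2) dis2 s2 by blast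
    qed
    finally show "(\<Sum>i<n. norm (f (v i) - f (u i))) < \<epsilon>" by simp
  qed (use \<delta>1 \<delta>2 in auto)
qed

lemma ac_on_shift:
  fixes f :: "real \<Rightarrow> 'a::real_normed_vector"
  assumes f: "ac_on (a + c) (b + c) f"
  shows "ac_on a b (\<lambda>x. f (x + c))"
proof (rule ac_onI)
  fix \<epsilon> :: real assume \<epsilon>: "\<epsilon> > 0"
  obtain \<delta> where \<delta>': "\<delta> > 0"
    "\<forall>(I :: nat set) u v. finite I \<and> (\<forall>i\<in>I. a + c \<le> u i \<and> u i \<le> v i \<and> v i \<le> b + c) \<and>
       disjoint_family_on (\<lambda>i. {u i<..<v i}) I \<and> (\<Sum>i\<in>I. v i - u i) < \<delta> \<longrightarrow>
       (\<Sum>i\<in>I. norm (f (v i) - f (u i))) < \<epsilon>"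
    using ac_onD[where 'i = nat, OF f \<epsilon>] by (elim exE conjE) (rule that)
    note \<delta> = \<delta>'(1) \<delta>'(2)[THEN spec, THEN spec, THEN spec]
  show "\<exists>\<delta>>0. \<forall>(n::nat) u v. (\<forall>i\<in>{..<n}. a \<le> u i \<and> u i \<le> v i \<and> v i \<le> b) \<longrightarrow>
       disjoint_family_on (\<lambda>i. {u i<..<v i}) {..<n} \<longrightarrow> (\<Sum>i<n. v i - u i) < \<delta> \<longrightarrow>
       (\<Sum>i<n. norm (f (v i + c) - f (u i + c))) < \<epsilon>"
  proof (rule exI[of _ \<delta>], intro conjI allI impI)
    fix n :: nat and u v :: "nat \<Rightarrow> real"
    assume uv: "\<forall>i\<in>{..<n}. a \<le> u i \<and> u i \<le> v i \<and> v i \<le> b"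
      and dis: "disjoint_family_on (\<lambda>i. {u i<..<v i}) {..<n}"
      and s: "(\<Sum>i<n. v i - u i) < \<delta>"
    have "disjoint_family_on (\<lambda>i. {u i + c<..<v i + c}) {..<n}"
      unfolding disjoint_family_on_def
    proof (intro ballI impI equals0I)
      fix i j x assume ij: "i \<in> {..<n}" "j \<in> {..<n}" "i \<noteq> j"
        and x: "x \<in> {u i + c<..<v i + c} \<inter> {u j + c<..<v j + c}"
      have "{u i<..<v i} \<inter> {u j<..<v j} = {}"
        by (rule disjoint_family_onD[OF dis ij])
      moreover have "x - c \<in> {u i<..<v i} \<inter> {u j<..<v j}" using x by auto
      ultimately show False by blast
    qed
    then show "(\<Sum>i<n. norm (f (v i + c) - f (u i + c))) < \<epsilon>"
      using \<delta>(2)[of "{..<n}" "\<lambda>i. u i + c" "\<lambda>i. v i + c"] uv s by auto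
  qed (use \<delta> in auto)
qed

subsection \<open>The normalised angle measure\<close>

lemma emeasure_circle_ivl: "emeasure lebesgue {0..<2*pi} = ennreal (2*pi)"
  by simp

lemma haar_angle_eq_density:
  "haar_angle = density lebesgue (\<lambda>t. ennreal (indicator {0..<2*pi} t / (2*pi)))"
  unfolding haar_angle_def uniform_measure_def emeasure_circle_ivl
  by (intro arg_cong[where f = "density lebesgue"] ext)
     (auto simp: indicator_def divide_ennreal[symmetric])

lemma sets_haar_angle [simp, measurable_cong]: "sets haar_angle = sets lebesgue"
  and space_haar_angle [simp]: "space haar_angle = UNIV"
  by (simp_all add: haar_angle_def)

lemma measurable_haar_angle: "measurable haar_angle N = measurable lebesgue N"
  by (rule measurable_cong_sets) simp_all

lemma prob_space_haar_angle: "prob_space haar_angle"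
  unfolding haar_angle_def by (rule prob_space_uniform_measure) auto

lemma AE_haar_angle_iff: "(AE t in haar_angle. P t) \<longleftrightarrow> (AE t in lebesgue. t \<in> {0..<2*pi} \<longrightarrow> P t)"
  unfolding haar_angle_def by (rule AE_uniform_measure) auto

lemma AE_haar_angle_ivl: "AE t in haar_angle. t \<in> {0..<2*pi}"
  by (simp add: AE_haar_angle_iff)

lemma AE_haar_angle_notin: "negligible B \<Longrightarrow> AE t in haar_angle. t \<notin> B"
  unfolding AE_haar_angle_iff
  by (rule eventually_mono[OF AE_not_in[of B]]) (auto simp: negligible_iff_null_sets)

lemma AE_lebesgue_neq: "AE t in lebesgue. t \<noteq> (c::real)"
  using AE_not_in[of "{c}" lebesgue] by simp

text \<open>The bridge between \<open>haar_angle\<close> and the gauge integral, where the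
  fundamental theorem lives. \<open>haar_angle\<close> keeps the Lebesgue sets of the whole line, so
  measurability is a condition on the whole line while absolute integrability concerns one
  period.\<close>

lemma
  fixes f :: "real \<Rightarrow> 'a::euclidean_space"
  shows integrable_haar_angle_iff:
      "integrable haar_angle f \<longleftrightarrow> f \<in> borel_measurable lebesgue \<and> f absolutely_integrable_on {0..2*pi}"
    and integral_haar_angle:
      "f \<in> borel_measurable lebesgue \<Longrightarrow>
        (LINT t|haar_angle. f t) = (LINT t:{0..2*pi}|lebesgue. f t) /\<^sub>R (2*pi)"
proof -
  \<comment> \<open>The half-open and the closed period differ only in the point 2 pi.\<close>
  have ae: "AE t in lebesgue. (indicator {0..<2*pi} t / (2*pi)) *\<^sub>R f t
      = inverse (2*pi) *\<^sub>R (indicator {0..2*pi} t *\<^sub>R f t)"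
    by (rule eventually_mono[OF AE_lebesgue_neq[of "2*pi"]]) (auto simp: indicator_def field_simps)
  have ind: "(\<lambda>t. indicator {0..<2*pi} t / (2*pi)) \<in> borel_measurable lebesgue"
    by (intro borel_measurable_divide borel_measurable_indicator borel_measurable_const) simp
  have cong: "f \<in> borel_measurable lebesgue \<Longrightarrow>
      (\<lambda>t. (indicator {0..<2*pi} t / (2*pi)) *\<^sub>R f t) \<in> borel_measurable lebesgue"
    "f \<in> borel_measurable lebesgue \<Longrightarrow>
      (\<lambda>t. inverse (2*pi) *\<^sub>R (indicator {0..2*pi} t *\<^sub>R f t)) \<in> borel_measurable lebesgue"
    by (intro borel_measurable_scaleR borel_measurable_divide borel_measurable_indicator
        borel_measurable_const; simp)+
  have *: "integrable lebesgue (\<lambda>t. c *\<^sub>R g t) \<longleftrightarrow> integrable lebesgue g" if "c \<noteq> 0"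
    for c :: real and g :: "real \<Rightarrow> 'a"
    using integrable_scaleR_right[of "inverse c" lebesgue "\<lambda>t. c *\<^sub>R g t"] that by auto
  have eq: "integrable haar_angle f \<longleftrightarrow> f absolutely_integrable_on {0..2*pi}"
    if "f \<in> borel_measurable lebesgue"
  proof -
    have "integrable haar_angle f \<longleftrightarrow> integrable lebesgue (\<lambda>t. (indicator {0..<2*pi} t / (2*pi)) *\<^sub>R f t)"
      unfolding haar_angle_eq_density by (rule integrable_density) (use that ind in auto)
    also have "\<dots> \<longleftrightarrow> integrable lebesgue (\<lambda>t. inverse (2*pi) *\<^sub>R (indicator {0..2*pi} t *\<^sub>R f t))"
      by (rule integrable_cong_AE[OF cong[OF that] ae])
    also have "\<dots> \<longleftrightarrow> f absolutely_integrable_on {0..2*pi}"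
      unfolding set_integrable_def
      by (rule *) simp
    finally show ?thesis .
  qed
  have "integrable haar_angle f \<longrightarrow> f \<in> borel_measurable lebesgue"
    using borel_measurable_integrable[of haar_angle f] by (simp only: measurable_haar_angle) simp
  with eq show "integrable haar_angle f \<longleftrightarrow> f \<in> borel_measurable lebesgue \<and> f absolutely_integrable_on {0..2*pi}"
    by (cases "f \<in> borel_measurable lebesgue") simp_all
  show "(LINT t|haar_angle. f t) = (LINT t:{0..2*pi}|lebesgue. f t) /\<^sub>R (2*pi)"
    if f: "f \<in> borel_measurable lebesgue"
  proof -
    have "(LINT t|haar_angle. f t) = (LINT t|lebesgue. (indicator {0..<2*pi} t / (2*pi)) *\<^sub>R f t)"
      unfolding haar_angle_eq_density by (rule integral_density) (use f ind in auto)
    also have "\<dots> = (LINT t|lebesgue. inverse (2*pi) *\<^sub>R (indicator {0..2*pi} t *\<^sub>R f t))"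
      by (rule integral_cong_AE[OF cong[OF f] ae])
    also have "\<dots> = (LINT t:{0..2*pi}|lebesgue. f t) /\<^sub>R (2*pi)"
      unfolding set_lebesgue_integral_def by (rule integral_scaleR_right)
    finally show ?thesis .
  qed
qed

lemma integral_haar_angle_eq:
  fixes f :: "real \<Rightarrow> complex"
  assumes "integrable haar_angle f" "(f has_integral I) {0..2*pi}"
  shows "(LINT t|haar_angle. f t) = I / (2*pi)"
proof -
  have f: "f \<in> borel_measurable lebesgue" "f absolutely_integrable_on {0..2*pi}"
    using assms(1) unfolding integrable_haar_angle_iff by auto
  have "(LINT t|haar_angle. f t) = integral {0..2*pi} f /\<^sub>R (2*pi)"
    unfolding integral_haar_angle[OF f(1)] set_lebesgue_integral_eq_integral(2)[OF f(2)] ..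
  then show ?thesis unfolding integral_unique[OF assms(2)] by (simp add: scaleR_conv_of_real field_simps)
qed

lemma continuous_imp_borel_measurable_lebesgue:
  fixes g :: "real \<Rightarrow> complex"
  shows "continuous_on UNIV g \<Longrightarrow> g \<in> borel_measurable lebesgue"
  by (simp add: borel_measurable_continuous_onI measurable_completion)

lemma integrable_haar_angle_mult_bounded:
  fixes f g :: "real \<Rightarrow> complex"
  assumes f: "integrable haar_angle f" and g: "continuous_on UNIV g" "\<And>t. norm (g t) \<le> C"
  shows "integrable haar_angle (\<lambda>t. g t * f t)"
proof (rule Bochner_Integration.integrable_bound)
  show "integrable haar_angle (\<lambda>t. C * norm (f t))" using f by simp
  have "g \<in> borel_measurable haar_angle"
    using continuous_imp_borel_measurable_lebesgue[OF g(1)] by (simp add: measurable_haar_angle)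
  then show "(\<lambda>t. g t * f t) \<in> borel_measurable haar_angle" using f by auto
  show "AE t in haar_angle. norm (g t * f t) \<le> norm (C * norm (f t))"
    using g(2) by (auto simp: norm_mult intro!: AE_I2 mult_right_mono order_trans[OF _ abs_ge_self])
qed

lemma integrable_haar_angle_cis:
  assumes "integrable haar_angle f"
  shows "integrable haar_angle (\<lambda>t. cis (of_int k * t) * f t)"
  by (rule integrable_haar_angle_mult_bounded[OF assms, of _ 1]) (auto intro!: continuous_intros)

text \<open>The part over [0, c] is moved by one period to [p, p + c] and glued to the part over
  [c, p].\<close>

lemma periodic_has_integral_shift:
  fixes f :: "real \<Rightarrow> 'a::euclidean_space"
  assumes I: "(f has_integral I) {0..p}" and per: "\<And>t. f (t + p) = f t" and c: "0 \<le> c" "c \<le> p"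
  shows "((\<lambda>t. f (t + c)) has_integral I) {0..p}"
proof -
  have int: "f integrable_on {0..p}" using I by blast
  have 1: "(f has_integral integral {0..c} f) {0..c}"
    using integrable_on_subinterval[OF int, of 0 c] c by (auto intro: integrable_integral)
  have 2: "(f has_integral integral {c..p} f) {c..p}"
    using integrable_on_subinterval[OF int, of c p] c by (auto intro: integrable_integral)
  have "(f has_integral integral {0..c} f) {p..p+c}"
    using 1 per by (subst has_integral_shift_real_ivl_iff[where c = p]) simp
  then have "(f has_integral (integral {c..p} f + integral {0..c} f)) {c..p+c}"
    by (rule has_integral_combine[OF _ _ 2, rotated 2]) (use c in auto)
  moreover have "integral {c..p} f + integral {0..c} f = I"
    using has_integral_combine[OF c 1 2] I by (metis add.commute has_integral_unique)
  ultimately show ?thesis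
    using has_integral_shift_real_ivl[of f I c "p + c" c] by simp
qed

lemma
  fixes f :: "real \<Rightarrow> complex"
  assumes f: "integrable haar_angle f" and per: "\<And>t. f (t + 2*pi) = f t" and c: "0 \<le> c" "c \<le> 2*pi"
  shows integrable_haar_angle_shift: "integrable haar_angle (\<lambda>t. f (t + c))"
    and integral_haar_angle_shift: "(LINT t|haar_angle. f (t + c)) = (LINT t|haar_angle. f t)"
proof -
  have fm: "f \<in> borel_measurable lebesgue" and fa: "f absolutely_integrable_on {0..2*pi}"
    using f by (auto simp: integrable_haar_angle_iff)
  \<comment> \<open>\<open>f\<close> is only Lebesgue measurable, so the translation must be
    measurable from \<open>lebesgue\<close> to \<open>lebesgue\<close>; its continuity alone would
    not suffice.\<close>
  have "(\<lambda>t. c + (\<Sum>j\<in>Basis. (1 * (t \<bullet> j)) *\<^sub>R j)) \<in> lebesgue \<rightarrow>\<^sub>M lebesgue"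
    by (rule lebesgue_affine_measurable) auto
  then have "(\<lambda>t. t + c) \<in> lebesgue \<rightarrow>\<^sub>M lebesgue" by (simp add: add.commute)
  then have m: "(\<lambda>t. f (t + c)) \<in> borel_measurable lebesgue"
    using fm by (rule measurable_compose)
  have i: "(f has_integral integral {0..2*pi} f) {0..2*pi}"
    and n: "((\<lambda>t. norm (f t)) has_integral integral {0..2*pi} (\<lambda>t. norm (f t))) {0..2*pi}"
    using fa unfolding absolutely_integrable_on_def by (auto intro: integrable_integral)
  note i' = periodic_has_integral_shift[OF i per c]
  have "(\<lambda>t. norm (f (t + c))) integrable_on {0..2*pi}"
    using periodic_has_integral_shift[OF n _ c] per by (auto simp: integrable_on_def)
  then show int: "integrable haar_angle (\<lambda>t. f (t + c))"
    using m i' by (auto simp: integrable_haar_angle_iff absolutely_integrable_on_def)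
  show "(LINT t|haar_angle. f (t + c)) = (LINT t|haar_angle. f t)"
    using integral_haar_angle_eq[OF int i'] integral_haar_angle_eq[OF f i] by simp
qed

subsection \<open>Differentiation with respect to the angle\<close>

definition euler_angle :: "(real \<Rightarrow> complex) \<Rightarrow> real \<Rightarrow> complex" where
  "euler_angle h t = - \<i> * vector_derivative h (at t)"

definition cderiv_angle :: "(real \<Rightarrow> complex) \<Rightarrow> real \<Rightarrow> complex" where
  "cderiv_angle h t = cis (- t) * euler_angle h t"

definition periodic2pi :: "(real \<Rightarrow> complex) \<Rightarrow> bool" where
  "periodic2pi h \<longleftrightarrow> (\<forall>t. h (t + 2*pi) = h t)"

lemma has_vector_derivative_shift:
  fixes h :: "real \<Rightarrow> 'a::real_normed_vector"
  shows "((\<lambda>s. h (s + c)) has_vector_derivative d) (at t) \<longleftrightarrow> (h has_vector_derivative d) (at (t + c))"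
  by (simp add: has_vector_derivative_def has_derivative_at add_ac)

lemma has_vector_derivative_shift_0:
  fixes h :: "real \<Rightarrow> 'a::real_normed_vector"
  shows "((\<lambda>s. h (t + s)) has_vector_derivative d) (at 0) \<longleftrightarrow> (h has_vector_derivative d) (at t)"
  using has_vector_derivative_shift[of h t d 0] by (simp add: add.commute)

lemma differentiable_iff_has_vector_derivative:
  "h differentiable at t \<longleftrightarrow> (\<exists>d. (h has_vector_derivative d) (at t))"
  by (metis differentiableI_vector vector_derivative_works)

text \<open>No differentiability is assumed: both sides choose a vector derivative from the same
  predicate, so they agree even where none exists. This is what lets iterated derivatives be
  transported to the angle unconditionally.\<close>

lemma euler_cis: "euler f (cis t) = euler_angle (\<lambda>t. f (cis t)) t"
  unfolding euler_def euler_angle_def vector_derivative_def cis_mult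
  by (subst has_vector_derivative_shift_0[of "\<lambda>t. f (cis t)"]) simp

lemma cderiv_cis: "cderiv f (cis t) = cderiv_angle (\<lambda>t. f (cis t)) t"
  by (simp add: cderiv_def cderiv_angle_def euler_cis divide_inverse cis_inverse mult.commute)

lemma cderiv_funpow_cis: "(cderiv ^^ j) f (cis t) = (cderiv_angle ^^ j) (\<lambda>t. f (cis t)) t"
proof (induction j arbitrary: t)
  case (Suc j)
  then have "(\<lambda>t. (cderiv ^^ j) f (cis t)) = (cderiv_angle ^^ j) (\<lambda>t. f (cis t))" by auto
  then show ?case by (simp add: cderiv_cis)
qed simp

lemma cdifferentiable_cis: "cdifferentiable f (cis t) \<longleftrightarrow> (\<lambda>t. f (cis t)) differentiable at t"
  unfolding cdifferentiable_def differentiable_iff_has_vector_derivative cis_mult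
  by (subst has_vector_derivative_shift_0[of "\<lambda>t. f (cis t)"]) simp

lemma periodic2piD: "periodic2pi h \<Longrightarrow> h (t + 2*pi) = h t"
  by (simp add: periodic2pi_def)

lemma periodic2pi_circle: "periodic2pi (\<lambda>t. f (cis t))"
  by (simp add: periodic2pi_def cis.ctr)

lemma periodic2pi_cis_mult: "periodic2pi h \<Longrightarrow> periodic2pi (\<lambda>t. c * cis (of_int k * t) * h t)"
proof -
  have "cis (of_int k * (t + 2*pi)) = cis (of_int k * t)" for t
    using cis_multiple_2pi[of "of_int k"] by (simp add: distrib_left cis_mult[symmetric] mult.commute)
  then show "periodic2pi h \<Longrightarrow> ?thesis" by (simp add: periodic2pi_def)
qed

lemma periodic2pi_add: "periodic2pi f \<Longrightarrow> periodic2pi g \<Longrightarrow> periodic2pi (\<lambda>t. f t + g t)"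
  by (simp add: periodic2pi_def)

lemma periodic2pi_shift: "periodic2pi h \<Longrightarrow> periodic2pi (\<lambda>t. h (t + c))"
  unfolding periodic2pi_def by (metis add.assoc add.commute)

lemma periodic2pi_differentiable_iff:
  assumes "periodic2pi h"
  shows "h differentiable at (t + 2*pi) \<longleftrightarrow> h differentiable at t"
proof -
  have "(\<lambda>s. h (s + 2*pi)) = h" using assms by (auto simp: periodic2pi_def)
  then show ?thesis
    using has_vector_derivative_shift[of h "2*pi" _ t] by (simp add: differentiable_iff_has_vector_derivative)
qed

lemma euler_angle_shift: "euler_angle (\<lambda>s. h (s + c)) t = euler_angle h (t + c)"
  by (simp add: euler_angle_def vector_derivative_def has_vector_derivative_shift)

lemma periodic2pi_euler_angle:
  assumes "periodic2pi h"
  shows "periodic2pi (euler_angle h)"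
proof -
  have "(\<lambda>s. h (s + 2*pi)) = h" using assms by (auto simp: periodic2pi_def)
  then show ?thesis using euler_angle_shift[of h "2*pi"] by (simp add: periodic2pi_def)
qed

lemma differentiable_has_euler_angle:
  "h differentiable at t \<Longrightarrow> (h has_vector_derivative (\<i> * euler_angle h t)) (at t)"
  by (simp add: euler_angle_def vector_derivative_works mult.assoc[symmetric])

lemma euler_angle_eqI:
  "(h has_vector_derivative d) (at t) \<Longrightarrow> euler_angle h t = - \<i> * d"
  by (simp add: euler_angle_def vector_derivative_at)

lemma euler_angle_add:
  assumes "f differentiable at t" "g differentiable at t"
  shows "euler_angle (\<lambda>t. f t + g t) t = euler_angle f t + euler_angle g t"
  using assms by (simp add: euler_angle_def vector_derivative_add_at algebra_simps)

text \<open>The shape \<open>c * cis (k * t) * h t\<close> serves several purposes: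
  \<open>k = 0\<close> gives constant multiples, integer \<open>k\<close> multiplication by powers
  of z, and \<open>h = 1\<close> the exponentials themselves.\<close>

lemma has_vector_derivative_cis_mult:
  assumes "(h has_vector_derivative d) (at t)"
  shows "((\<lambda>t. c * cis (k * t) * h t) has_vector_derivative
    c * cis (k * t) * (d + \<i> * of_real k * h t)) (at t)"
proof -
  have "((\<lambda>t. cis (k * t)) has_vector_derivative \<i> * of_real k * cis (k * t)) (at t)"
    unfolding has_vector_derivative_def
    by (auto intro!: derivative_eq_intros simp: fun_eq_iff scaleR_conv_of_real)
  then have "((\<lambda>t. c * cis (k * t)) has_vector_derivative c * (\<i> * of_real k * cis (k * t))) (at t)"
    by (rule has_vector_derivative_mult_right)
  from has_vector_derivative_mult[OF this assms] show ?thesis by (simp add: algebra_simps)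
qed

lemma euler_angle_cis_mult:
  assumes "h differentiable at t"
  shows "euler_angle (\<lambda>t. c * cis (k * t) * h t) t = c * cis (k * t) * (euler_angle h t + of_real k * h t)"
  using euler_angle_eqI[OF has_vector_derivative_cis_mult[OF differentiable_has_euler_angle[OF assms], of c k]]
  by (simp add: algebra_simps)

lemma differentiable_cis_mult:
  assumes "h differentiable at t"
  shows "(\<lambda>t. c * cis (k * t) * h t) differentiable at t"
  using has_vector_derivative_cis_mult[OF differentiable_has_euler_angle[OF assms], of c k]
  by (auto simp: differentiable_iff_has_vector_derivative)

subsection \<open>Sobolev-type classes of periodic functions\<close>

text \<open>The exceptional set \<open>B\<close> collects the points where the last derivative may fail to exist.\<close>

definition exc :: "real set \<Rightarrow> nat \<Rightarrow> real set" where
  "exc B n = (if n = 0 then B else {})"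

text \<open>The periodic Sobolev class of order \<open>n\<close> with integrable last derivative and
  a named exceptional set. All derivatives below the last are continuous and absolutely continuous;
  the last one may fail to exist on \<open>B\<close>, because \<open>exc B n\<close> is nonempty
  only at the final step. Functions live on the whole line so that rotations become
  translations.\<close>

primrec csmooth :: "real set \<Rightarrow> nat \<Rightarrow> (real \<Rightarrow> complex) \<Rightarrow> bool" where
  "csmooth B 0 h \<longleftrightarrow> periodic2pi h \<and> integrable haar_angle h"
| "csmooth B (Suc n) h \<longleftrightarrow> periodic2pi h \<and> continuous_on UNIV h \<and> ac_on 0 (2*pi) h \<and>
     (\<forall>t. t \<notin> exc B n \<longrightarrow> h differentiable at t) \<and> csmooth B n (euler_angle h)"

lemma csmooth_periodic: "csmooth B n h \<Longrightarrow> periodic2pi h"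
  by (cases n) auto

text \<open>The rules for derivatives of sums and products hold only where the derivatives exist. At
  order 0 this leaves equality off a null set, which preserves measurability because
  \<open>lebesgue\<close> is complete; at higher order the two functions coincide.\<close>

lemma csmooth_cong:
  assumes f: "csmooth B n f" and B: "negligible B" and g: "periodic2pi g"
    and eq: "\<And>t. t \<notin> exc B n \<Longrightarrow> f t = g t"
  shows "csmooth B n g"
proof (cases n)
  case 0
  have m: "f \<in> borel_measurable lebesgue" and i: "integrable haar_angle f"
    using f 0 by (auto simp: integrable_haar_angle_iff)
  have ae: "AE t in lebesgue. f t = g t"
    using AE_not_in[of B lebesgue] B eq 0 by (auto simp: negligible_iff_null_sets exc_def elim: eventually_mono)
  have g': "g \<in> borel_measurable lebesgue" by (rule borel_measurable_AE[OF m ae])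
  have "integrable haar_angle g"
    by (rule integrable_cong_AE_imp[OF i])
       (use g' ae in \<open>auto simp: measurable_haar_angle AE_haar_angle_iff elim: eventually_mono\<close>)
  then show ?thesis using g 0 by simp
next
  case (Suc m)
  then have "f = g" using eq by (auto simp: exc_def)
  then show ?thesis using f by simp
qed

lemma continuous_integrable_haar_angle:
  assumes "continuous_on UNIV (h :: real \<Rightarrow> complex)"
  shows "integrable haar_angle h"
  using assms unfolding integrable_haar_angle_iff
  by (auto intro!: continuous_imp_borel_measurable_lebesgue absolutely_integrable_continuous_real
      intro: continuous_on_subset)

text \<open>The derivative that may fail on \<open>B\<close> is the one given up, so any other
  exceptional set may be named instead.\<close>

lemma csmooth_weaken: "csmooth B (Suc n) h \<Longrightarrow> csmooth B' n h"
proof (induction n arbitrary: h)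
  case 0
  then show ?case by (simp add: continuous_integrable_haar_angle)
next
  case (Suc n)
  have "csmooth B (Suc n) (euler_angle h)" using Suc.prems by simp
  then show ?case using Suc by (auto simp: exc_def)
qed

lemma csmooth_mono: "csmooth B n h \<Longrightarrow> m \<le> n \<Longrightarrow> csmooth B m h"
proof (induction n)
  case (Suc n)
  then show ?case using csmooth_weaken[OF Suc.prems(1), of B] by (cases "m = Suc n") auto
qed simp

lemma csmooth_differentiable: "csmooth B (Suc n) h \<Longrightarrow> t \<notin> exc B n \<Longrightarrow> h differentiable at t"
  by simp

lemma csmooth_add:
  assumes B: "negligible B"
  shows "csmooth B n f \<Longrightarrow> csmooth B n g \<Longrightarrow> csmooth B n (\<lambda>t. f t + g t)"
proof (induction n arbitrary: f g)
  case 0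
  then show ?case by (simp add: periodic2pi_add)
next
  case (Suc n)
  have "csmooth B n (\<lambda>t. euler_angle f t + euler_angle g t)"
    using Suc by simp
  then have "csmooth B n (euler_angle (\<lambda>t. f t + g t))"
    by (rule csmooth_cong[OF _ B])
       (use Suc.prems in \<open>auto intro!: periodic2pi_euler_angle periodic2pi_add simp: euler_angle_add\<close>)
  then show ?case
    using Suc.prems by (auto intro!: periodic2pi_add continuous_on_add ac_on_add differentiable_add)
qed

lemma ac_on_C1:
  fixes h h' :: "real \<Rightarrow> complex"
  assumes h: "\<And>t. (h has_vector_derivative h' t) (at t)" and h': "continuous_on UNIV h'"
  shows "ac_on a b h"
proof -
  have "bounded (h' ` {a..b})"
    using h' by (intro compact_imp_bounded compact_continuous_image) (auto intro: continuous_on_subset)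
  then obtain C where C: "C > 0" "\<And>t. t \<in> {a..b} \<Longrightarrow> norm (h' t) \<le> C"
    unfolding bounded_pos by (metis imageI)
  have "C-lipschitz_on {a..b} h"
  proof (rule bounded_derivative_imp_lipschitz)
    show "(h has_derivative (\<lambda>s. s *\<^sub>R h' t)) (at t within {a..b})" for t
      using h[of t] unfolding has_vector_derivative_def by (rule has_derivative_at_withinI)
    show "onorm (\<lambda>s. s *\<^sub>R h' t) \<le> C" if "t \<in> {a..b}" for t
      by (rule onorm_le) (use C(2)[OF that] in \<open>simp add: mult.commute[of C] mult_left_mono\<close>)
  qed (use C in auto)
  then show ?thesis by (rule ac_on_lipschitz)
qed

lemma ac_on_cis: "ac_on a b (\<lambda>t. c * cis (k * t))"
proof (rule ac_on_C1)
  show "((\<lambda>t. c * cis (k * t)) has_vector_derivative c * cis (k * t) * (0 + \<i> * of_real k * 1)) (at t)" for t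
    using has_vector_derivative_cis_mult[OF has_vector_derivative_const[of 1], of c k t] by simp
qed (auto intro!: continuous_intros)

lemma csmooth_cis_mult:
  assumes B: "negligible B"
  shows "csmooth B n h \<Longrightarrow> csmooth B n (\<lambda>t. c * cis (of_int k * t) * h t)"
proof (induction n arbitrary: h c)
  case 0
  then show ?case
    using integrable_haar_angle_cis[of h k] periodic2pi_cis_mult[of h c k] by (simp add: mult.assoc)
next
  case (Suc n)
  \<comment> \<open>The two terms of the product rule. The undifferentiated one has an order to
    spare, and its factor \<open>k\<close> is absorbed into the constant, hence the induction over
    arbitrary \<open>c\<close>.\<close>
  have "csmooth B n (\<lambda>t. c * cis (of_int k * t) * euler_angle h t + (c * of_int k) * cis (of_int k * t) * h t)"
    using Suc csmooth_weaken[OF Suc.prems] by (intro csmooth_add[OF B] Suc.IH) auto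
  then have "csmooth B n (euler_angle (\<lambda>t. c * cis (of_int k * t) * h t))"
  proof (rule csmooth_cong[OF _ B])
    show "periodic2pi (euler_angle (\<lambda>t. c * cis (of_int k * t) * h t))"
      by (intro periodic2pi_euler_angle periodic2pi_cis_mult csmooth_periodic[OF Suc.prems])
    show "c * cis (of_int k * t) * euler_angle h t + (c * of_int k) * cis (of_int k * t) * h t
        = euler_angle (\<lambda>t. c * cis (of_int k * t) * h t) t" if "t \<notin> exc B n" for t
      by (subst euler_angle_cis_mult[OF csmooth_differentiable[OF Suc.prems that]]) (simp add: algebra_simps)
  qed
  then show ?case
    using Suc.prems
    by (auto intro!: periodic2pi_cis_mult continuous_intros ac_on_mult ac_on_cis differentiable_cis_mult
        intro: continuous_on_subset)
qed

lemma csmooth_cmult: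
  assumes B: "negligible B" and h: "csmooth B n h"
  shows "csmooth B n (\<lambda>t. c * h t)"
  using csmooth_cis_mult[OF B h, of c 0] by simp

lemma csmooth_zero: "csmooth B n (\<lambda>_. 0)"
proof (induction n)
  case (Suc n)
  have "euler_angle (\<lambda>_. 0) = (\<lambda>_. 0)" by (auto intro!: ext euler_angle_eqI[where d = 0, simplified])
  then show ?case using Suc by (simp add: periodic2pi_def ac_on_const)
qed (simp add: periodic2pi_def)

lemma csmooth_sum:
  assumes B: "negligible B" and "\<And>i. i \<in> I \<Longrightarrow> csmooth B n (h i)"
  shows "csmooth B n (\<lambda>t. \<Sum>i\<in>I. h i t)"
  using assms(2)
  by (induction I rule: infinite_finite_induct) (auto intro!: csmooth_add[OF B] csmooth_zero)

text \<open>The shifted period leaves [0, 2 pi], so absolute continuity is first copied to the next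
  period, glued, and then restricted.\<close>

lemma ac_on_periodic_shift:
  assumes h: "ac_on 0 (2*pi) h" and per: "periodic2pi h" and c: "0 \<le> c" "c \<le> 2*pi"
  shows "ac_on 0 (2*pi) (\<lambda>t. h (t + c))"
proof -
  have "h (t + - (2*pi)) = h t" for t
    using periodic2piD[OF per, of "t + - (2*pi)"] by simp
  then have "(\<lambda>t. h (t + - (2*pi))) = h" by (rule ext)
  moreover have "ac_on (2*pi) (4*pi) (\<lambda>t. h (t + - (2*pi)))"
    by (rule ac_on_shift) (use h in simp)
  ultimately have "ac_on (2*pi) (4*pi) h" by simp
  then have "ac_on 0 (4*pi) h" by (rule ac_on_concat[OF h]) auto
  then have "ac_on (0 + c) (2*pi + c) h" by (rule ac_on_subset) (use c in auto)
  then show ?thesis by (rule ac_on_shift)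
qed

lemma csmooth_shift:
  assumes c: "0 \<le> c" "c \<le> 2*pi"
  shows "csmooth B n h \<Longrightarrow> csmooth {t. t + c \<in> B} n (\<lambda>t. h (t + c))"
proof (induction n arbitrary: h)
  case 0
  then have "periodic2pi (\<lambda>t. h (t + c))" by (intro periodic2pi_shift) simp
  then show ?case using 0 integrable_haar_angle_shift[of h c] c by (simp add: periodic2piD)
next
  case (Suc n)
  have "periodic2pi (\<lambda>t. h (t + c))" 
    by (rule periodic2pi_shift[OF csmooth_periodic[OF Suc.prems]])
  moreover have "continuous_on UNIV (\<lambda>t. h (t + c))"
    using Suc.prems by (auto intro!: continuous_on_compose2[of UNIV h] continuous_intros)
  moreover have "(\<lambda>t. h (t + c)) differentiable at t" if "t \<notin> exc {t. t + c \<in> B} n" for t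
    using csmooth_differentiable[OF Suc.prems, of "t + c"] that
    by (auto simp: exc_def differentiable_iff_has_vector_derivative has_vector_derivative_shift split: if_splits)
  moreover have "euler_angle (\<lambda>t. h (t + c)) = (\<lambda>t. euler_angle h (t + c))"
    by (simp add: fun_eq_iff euler_angle_shift)
  ultimately show ?case
    using Suc c by (auto intro!: ac_on_periodic_shift)
qed

text \<open>The fundamental theorem for t times h. The factor t destroys periodicity, and exactly
  this leaves the boundary term 2 pi h(0).\<close>

lemma csmooth_by_parts:
  fixes h :: "real \<Rightarrow> complex"
  assumes B: "negligible B" and h: "csmooth B (Suc n) h"
  shows "((\<lambda>t. of_real t * euler_angle h t) has_integral
    (- \<i> * (2 * pi * h 0) + \<i> * integral {0..2*pi} h)) {0..2*pi}"
proof -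
  have diff: "h differentiable at t" if "t \<notin> B" for t
    using csmooth_differentiable[OF h, of t] that by (auto simp: exc_def)
  have c: "continuous_on {0..2*pi} h" using h by (auto intro: continuous_on_subset)
  have "ac_on 0 (2*pi) (of_real :: real \<Rightarrow> complex)"
    by (rule ac_on_C1[where h' = "\<lambda>_. 1"])
       (auto simp: has_vector_derivative_def scaleR_conv_of_real intro!: derivative_eq_intros)
  then have "ac_on 0 (2*pi) (\<lambda>t. of_real t * h t)" using h by (intro ac_on_mult) auto
  moreover have "((\<lambda>t. of_real t * h t) has_vector_derivative
      (of_real t * (\<i> * euler_angle h t) + 1 * h t)) (at t within {0..2*pi})" if "t \<in> {0..2*pi} - B" for t
  proof (rule has_vector_derivative_at_within, rule has_vector_derivative_mult)
    show "(of_real has_vector_derivative (1 :: complex)) (at t)"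
      by (auto simp: has_vector_derivative_def scaleR_conv_of_real intro!: derivative_eq_intros)
    show "(h has_vector_derivative \<i> * euler_angle h t) (at t)"
      using diff that by (intro differentiable_has_euler_angle) auto
  qed
  ultimately have "((\<lambda>t. of_real t * (\<i> * euler_angle h t) + 1 * h t) has_integral
      (of_real (2*pi) * h (2*pi) - of_real 0 * h 0)) {0..2*pi}"
    by (intro fundamental_theorem_of_calculus_ac[OF _ _ B]) auto
  from has_integral_diff[OF this integrable_integral[OF integrable_continuous_interval[OF c]]]
  have "((\<lambda>t. of_real t * (\<i> * euler_angle h t)) has_integral
      (2*pi * h 0 - integral {0..2*pi} h)) {0..2*pi}"
    using periodic2piD[OF csmooth_periodic[OF h], of 0] by simp
  from has_integral_mult_right[OF this, of "- \<i>"] show ?thesis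
    by (simp add: algebra_simps)
qed

lemma integral_euler_angle:
  fixes h :: "real \<Rightarrow> complex"
  assumes B: "negligible B" and h: "csmooth B (Suc n) h"
  shows "(LINT t|haar_angle. euler_angle h t) = 0"
proof -
  have diff: "h differentiable at t" if "t \<notin> B" for t
    using csmooth_differentiable[OF h, of t] that by (auto simp: exc_def)
  have "((\<lambda>t. \<i> * euler_angle h t) has_integral (h (2*pi) - h 0)) {0..2*pi}"
    by (rule fundamental_theorem_of_calculus_ac[OF _ _ B])
       (use h diff in \<open>auto intro!: has_vector_derivative_at_within differentiable_has_euler_angle\<close>)
  from has_integral_mult_right[OF this, of "- \<i>"]
  have "(euler_angle h has_integral 0) {0..2*pi}"
    using periodic2piD[OF csmooth_periodic[OF h], of 0] by (simp add: mult.assoc[symmetric])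
  moreover have "csmooth B 0 (euler_angle h)"
    by (rule csmooth_mono[of B n]) (use h in auto)
  ultimately show ?thesis by (simp add: integral_haar_angle_eq)
qed

subsection \<open>The functions \<open>Q\<^sub>j\<close> on the angle\<close>

definition euler_plus :: "complex \<Rightarrow> (real \<Rightarrow> complex) \<Rightarrow> real \<Rightarrow> complex" where
  "euler_plus a h t = euler_angle h t + a * h t"

primrec Q_angle :: "(real \<Rightarrow> complex) \<Rightarrow> nat \<Rightarrow> real \<Rightarrow> complex" where
  "Q_angle h 0 = h"
| "Q_angle h (Suc j) = euler_plus (of_nat j) (Q_angle h j)"

text \<open>Commuting \<open>\<partial>\<^sup>j\<close> past \<open>z\<^sup>j\<^sup>-\<^sup>1\<close> produces the factors \<open>z\<partial> + m\<close> of \<open>Q\<^sub>j\<close> in the order opposite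
  to the recursion \<open>Q\<^sub>j\<^sub>+\<^sub>1 = (z\<partial> + j) Q\<^sub>j\<close>.\<close>

primrec euler_prod :: "(real \<Rightarrow> complex) \<Rightarrow> nat \<Rightarrow> int \<Rightarrow> real \<Rightarrow> complex" where
  "euler_prod h 0 m = h"
| "euler_prod h (Suc j) m = euler_plus (of_int (m + 1)) (euler_prod h j (m + 1))"

context
  fixes B :: "real set"
  assumes B: "negligible B"
begin

lemma csmooth_euler_plus: "csmooth B (Suc n) h \<Longrightarrow> csmooth B n (euler_plus a h)"
  unfolding euler_plus_def[abs_def]
  using csmooth_weaken[of B n h B] by (intro csmooth_add[OF B] csmooth_cmult[OF B]) auto

lemma csmooth_Q_angle: "csmooth B (j + n) h \<Longrightarrow> csmooth B n (Q_angle h j)"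
  by (induction j arbitrary: n) (auto intro!: csmooth_euler_plus simp del: csmooth.simps)

lemma csmooth_euler_prod: "csmooth B (j + n) h \<Longrightarrow> csmooth B n (euler_prod h j m)"
  by (induction j arbitrary: n m) (auto intro!: csmooth_euler_plus simp del: csmooth.simps)

text \<open>Both sides expand to the same second-order expression; \<open>exc\<close> enters through
  the second derivative.\<close>

lemma euler_plus_commute:
  assumes g: "csmooth B (Suc (Suc n)) g" and t: "t \<notin> exc B n"
  shows "euler_plus a (euler_plus b g) t = euler_plus b (euler_plus a g) t"
proof -
  have 1: "g differentiable at t" using csmooth_differentiable[OF g, of t] by (simp add: exc_def)
  have 2: "euler_angle g differentiable at t" using g t by simp
  have 3: "euler_angle (euler_plus c g) t = euler_angle (euler_angle g) t + c * euler_angle g t" for c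
  proof -
    have "euler_angle (\<lambda>t. c * cis (0 * t) * g t) t = c * cis (0 * t) * (euler_angle g t + of_real 0 * g t)"
      by (rule euler_angle_cis_mult[OF 1])
    moreover have "(\<lambda>t. c * g t) differentiable at t"
      using differentiable_cis_mult[OF 1, of c 0] by simp
    ultimately show ?thesis
      unfolding euler_plus_def[abs_def] using 2 by (simp add: euler_angle_add)
  qed
  show ?thesis unfolding euler_plus_def[of a] euler_plus_def[of b] 3 unfolding euler_plus_def
    by (simp add: algebra_simps)
qed

text \<open>The innermost factor of the product is moved to the front, one transposition of
  neighbouring factors per induction step.\<close>

lemma euler_prod_outer:
  "csmooth B (Suc j + n) h \<Longrightarrow> t \<notin> exc B n \<Longrightarrow>
    euler_prod h (Suc j) m t = euler_plus (of_int (m + 1 + int j)) (euler_prod h j m) t"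
proof (induction j arbitrary: n m t)
  case (Suc j)
  \<comment> \<open>The next differentiation costs one order, so the induction hypothesis is used at
    \<open>Suc n\<close>. There \<open>exc\<close> is empty, and the result is an equality of
    functions that may be differentiated.\<close>
  have "euler_prod h (Suc j) (m + 1) = euler_plus (of_int (m + 1 + 1 + int j)) (euler_prod h j (m + 1))"
    by (intro ext Suc.IH[where n = "Suc n"]) (use Suc.prems in \<open>simp_all add: exc_def del: csmooth.simps\<close>)
  then have "euler_prod h (Suc (Suc j)) m t
      = euler_plus (of_int (m + 1)) (euler_plus (of_int (m + 1 + 1 + int j)) (euler_prod h j (m + 1))) t"
    by (subst euler_prod.simps) simp
  also have "\<dots> = euler_plus (of_int (m + 1 + 1 + int j)) (euler_plus (of_int (m + 1)) (euler_prod h j (m + 1))) t"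
    by (rule euler_plus_commute[OF csmooth_euler_prod Suc.prems(2)])
       (use Suc.prems in \<open>simp add: del: csmooth.simps\<close>)
  finally show ?case by (simp add: add_ac)
qed simp

lemma Q_angle_eq_euler_prod:
  "csmooth B (j + n) h \<Longrightarrow> t \<notin> exc B n \<Longrightarrow> Q_angle h j t = euler_prod h j (- 1) t"
proof (induction j arbitrary: n t)
  case (Suc j)
  have "Q_angle h j = euler_prod h j (- 1)"
    by (intro ext Suc.IH[where n = "Suc n"]) (use Suc.prems in \<open>simp_all add: exc_def del: csmooth.simps\<close>)
  then show ?case
    using euler_prod_outer[OF Suc.prems, of "- 1"] by simp
qed simp

text \<open>In operator form: \<open>\<partial>^j z^k = z^(k-j) (z\<partial> + k-j+1) ...
  (z\<partial> + k)\<close>. Each \<partial> equals \<open>z^(-1) z\<partial>\<close>, and moving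
  the current power of z to the left adds its exponent to \<open>z\<partial>\<close>.\<close>

lemma cderiv_angle_funpow:
  "csmooth B (j + n) h \<Longrightarrow> t \<notin> exc B n \<Longrightarrow>
    (cderiv_angle ^^ j) (\<lambda>t. cis (of_int k * t) * h t) t
      = cis (of_int (k - int j) * t) * euler_prod h j (k - int j) t"
proof (induction j arbitrary: n t)
  case (Suc j)
  have eq: "(cderiv_angle ^^ j) (\<lambda>t. cis (of_int k * t) * h t)
      = (\<lambda>t. 1 * cis (of_int (k - int j) * t) * euler_prod h j (k - int j) t)"
    unfolding mult_1
    by (intro ext Suc.IH[where n = "Suc n"]) (use Suc.prems in \<open>simp_all add: exc_def del: csmooth.simps\<close>)
  have "csmooth B (Suc n) (euler_prod h j (k - int j))"
    using Suc.prems(1) by (intro csmooth_euler_prod) (simp del: csmooth.simps)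
  note d = csmooth_differentiable[OF this Suc.prems(2)]
  have c: "cis (- t) * cis (of_int (k - int j) * t) = cis (of_int (k - int (Suc j)) * t)"
    by (simp add: cis_mult algebra_simps)
  have "(cderiv_angle ^^ Suc j) (\<lambda>t. cis (of_int k * t) * h t) t
      = (cis (- t) * cis (of_int (k - int j) * t)) *
        (euler_angle (euler_prod h j (k - int j)) t + of_real (of_int (k - int j)) * euler_prod h j (k - int j) t)"
    by (simp only: funpow.simps comp_def eq cderiv_angle_def euler_angle_cis_mult[OF d]) (simp add: mult.assoc)
  also have "\<dots> = cis (of_int (k - int (Suc j)) * t) * euler_prod h (Suc j) (k - int (Suc j)) t"
    unfolding c by (simp add: euler_plus_def)
  finally show ?case .
qed simp

lemma polya_Q_cis:
  assumes "csmooth B (j + n) (\<lambda>t. \<omega> (cis t))" "t \<notin> exc B n"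
  shows "polya_Q \<omega> j (cis t) = Q_angle (\<lambda>t. \<omega> (cis t)) j t"
proof -
  have "polya_Q \<omega> j (cis t) = cis t * (cderiv_angle ^^ j) (\<lambda>t. cis (of_int (int j - 1) * t) * \<omega> (cis t)) t"
    unfolding polya_Q_def cderiv_funpow_cis cis_power_int ..
  \<comment> \<open>For exponent j - 1 the remaining power is the inverse of z, which the outer
    factor of \<open>polya_Q\<close> cancels.\<close>
  also have "\<dots> = cis t * cis (- t) * euler_prod (\<lambda>t. \<omega> (cis t)) j (- 1) t"
    unfolding cderiv_angle_funpow[OF assms, of "int j - 1"] by simp
  finally show ?thesis using Q_angle_eq_euler_prod[OF assms] by (simp add: cis_mult)
qed

end

subsection \<open>Fourier coefficients\<close>

text \<open>The exponent has the sign of \<open>mellin\<close>, so this is the usual Fourier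
  coefficient of index -k.\<close>

definition fourier :: "(real \<Rightarrow> complex) \<Rightarrow> int \<Rightarrow> complex" where
  "fourier h k = (LINT t|haar_angle. cis (of_int k * t) * h t)"

lemma mellin_eq_fourier: "mellin w k = fourier (\<lambda>t. w (cis t)) k"
  by (simp add: mellin_def fourier_def cis_power_int)

lemma csmooth_integrable: "csmooth B n h \<Longrightarrow> integrable haar_angle h"
  using csmooth_mono[of B n h 0] by simp

text \<open>The derivative of the periodic function \<open>cis (k * t) * h t\<close> has mean zero;
  the product rule splits it into the two sides.\<close>

lemma fourier_euler_angle:
  assumes B: "negligible B" and h: "csmooth B (Suc n) h"
  shows "fourier (euler_angle h) k = - of_int k * fourier h k"
proof -
  let ?c = "\<lambda>t. cis (of_int k * t)"
  let ?g = "\<lambda>t. 1 * ?c t * h t"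
  have g: "csmooth B (Suc n) ?g" by (rule csmooth_cis_mult[OF B h])
  have i1: "integrable haar_angle (\<lambda>t. ?c t * euler_angle h t)"
    using h by (intro integrable_haar_angle_cis csmooth_integrable[of B n]) simp
  have i2: "integrable haar_angle (\<lambda>t. ?c t * h t)"
    using csmooth_integrable[OF h] by (rule integrable_haar_angle_cis)
  have "0 = (LINT t|haar_angle. euler_angle ?g t)" by (rule integral_euler_angle[OF B g, symmetric])
  also have "\<dots> = (LINT t|haar_angle. ?c t * euler_angle h t + of_int k * (?c t * h t))"
  proof (rule integral_cong_AE)
    have "csmooth B n (euler_angle ?g)" using g by simp
    then show "euler_angle ?g \<in> borel_measurable haar_angle"
      by (intro borel_measurable_integrable csmooth_integrable)
    show "(\<lambda>t. ?c t * euler_angle h t + of_int k * (?c t * h t)) \<in> borel_measurable haar_angle"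
      using i1 i2 by auto
    have "h differentiable at t" if "t \<notin> B" for t
      using csmooth_differentiable[OF h, of t] that by (auto simp: exc_def)
    then have "euler_angle ?g t = ?c t * euler_angle h t + of_int k * (?c t * h t)" if "t \<notin> B" for t
      using that by (subst euler_angle_cis_mult) (simp_all add: algebra_simps)
    then show "AE t in haar_angle. euler_angle ?g t = ?c t * euler_angle h t + of_int k * (?c t * h t)"
      by (rule eventually_mono[OF AE_haar_angle_notin[OF B]])
  qed
  also have "\<dots> = fourier (euler_angle h) k + of_int k * fourier h k"
    unfolding fourier_def using i1 i2 by simp
  finally show ?thesis by (simp add: eq_neg_iff_add_eq_0)
qed

lemma fourier_Q_angle:
  assumes B: "negligible B"
  shows "csmooth B j h \<Longrightarrow> fourier (Q_angle h j) k = (\<Prod>m<j. of_nat m - of_int k) * fourier h k"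
proof (induction j)
  case (Suc j)
  let ?q = "Q_angle h j"
  have q: "csmooth B 1 ?q" by (rule csmooth_Q_angle[OF B]) (use Suc.prems in simp)
  have i1: "integrable haar_angle (\<lambda>t. cis (of_int k * t) * euler_angle ?q t)"
    using q by (intro integrable_haar_angle_cis csmooth_integrable[of B 0]) simp
  have i2: "integrable haar_angle (\<lambda>t. cis (of_int k * t) * ?q t)"
    using csmooth_integrable[OF q] by (rule integrable_haar_angle_cis)
  have "fourier (Q_angle h (Suc j)) k = (LINT t|haar_angle. cis (of_int k * t) * euler_angle ?q t
      + of_nat j * (cis (of_int k * t) * ?q t))"
    unfolding fourier_def by (intro Bochner_Integration.integral_cong) (auto simp: euler_plus_def algebra_simps)
  also have "\<dots> = fourier (euler_angle ?q) k + of_nat j * fourier ?q k"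
    unfolding fourier_def using i1 i2 by simp
  also have "\<dots> = (of_nat j - of_int k) * fourier ?q k"
    using fourier_euler_angle[OF B, of 0 ?q k] q by (simp add: algebra_simps)
  finally show ?case using Suc.IH csmooth_weaken[OF Suc.prems] by simp
qed simp

text \<open>For \<open>k < j\<close> the factor \<open>m = k\<close> vanishes; otherwise this is a
  falling factorial of \<open>k\<close> up to sign.\<close>

lemma prod_nat_diff:
  "(\<Prod>m<j. of_nat m - of_nat k :: complex) = (if k < j then 0 else (-1) ^ j * fact k / fact (k - j))"
proof (induction j)
  case (Suc j)
  show ?case
  proof (cases "k < Suc j")
    case True
    then show ?thesis by (auto simp: Suc less_Suc_eq)
  next
    case False
    then obtain d where d: "k = Suc (j + d)" by (metis less_natE not_less_eq add_Suc_right add_Suc)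
    have e: "k - j = Suc d" "k - Suc j = d" "of_nat j - of_nat k = - (of_nat (Suc d) :: complex)"
      by (simp_all add: d)
    have "(\<Prod>m<Suc j. of_nat m - of_nat k :: complex) = (-1) ^ j * fact k / fact (Suc d) * - of_nat (Suc d)"
      unfolding prod.lessThan_Suc Suc.IH e using False by simp
    also have "\<dots> = (-1) ^ Suc j * fact k / fact d"
      unfolding fact_Suc by (simp del: of_nat_Suc)
    finally show ?thesis using False e by simp
  qed
qed simp

text \<open>The terms with \<open>k < j\<close> vanish. Shifting the rest by \<open>j\<close> and
  writing \<open>d = l - j\<close> leaves the alternating sum of the binomial coefficients of
  \<open>d\<close>, divided by d!.\<close>

lemma alternating_factorial_sum:
  "(\<Sum>k\<le>l. (-1) ^ k / (fact (l - k) * fact k) * (\<Prod>m<j. of_nat m - of_nat k)) = (if l = j then 1 else (0 :: complex))"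
proof (cases "j \<le> l")
  case False
  then show ?thesis by (auto simp: prod_nat_diff)
next
  case True
  then obtain d where d: "l = j + d" using le_Suc_ex by blast
  have set: "{j..l} = {0 + j..d + j}" by (simp add: d add.commute)
  have "(\<Sum>k\<le>l. (-1) ^ k / (fact (l - k) * fact k) * (\<Prod>m<j. of_nat m - of_nat k))
      = (\<Sum>k\<in>{j..l}. (-1) ^ k / (fact (l - k) * fact k) * ((-1) ^ j * fact k / fact (k - j)) :: complex)"
    by (rule sum.mono_neutral_cong_right) (auto simp: prod_nat_diff)
  also have "\<dots> = (\<Sum>i\<in>{0..d}. (-1) ^ (i + j) / (fact (l - (i + j)) * fact (i + j)) * ((-1) ^ j * fact (i + j) / fact (i + j - j)))"
    unfolding set by (rule sum.shift_bounds_cl_nat_ivl)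
  also have "\<dots> = (\<Sum>i\<le>d. (-1) ^ i * of_nat (d choose i)) / fact d"
    unfolding sum_divide_distrib atMost_atLeast0
  proof (intro sum.cong refl)
    fix i assume i: "i \<in> {0..d}"
    have "(-1) ^ (i + j) * (-1) ^ j = ((-1) ^ i :: complex)"
      by (simp add: power_add mult.assoc flip: power_mult_distrib)
    then have "(-1) ^ (i + j) / (fact (l - (i + j)) * fact (i + j)) * ((-1) ^ j * fact (i + j) / fact (i + j - j))
        = ((-1) ^ i :: complex) / (fact (d - i) * fact i)"
      by (simp add: d field_simps)
    also have "\<dots> = (-1) ^ i * of_nat (d choose i) / fact d"
      using i by (simp add: binomial_fact)
    finally show "(-1) ^ (i + j) / (fact (l - (i + j)) * fact (i + j)) * ((-1) ^ j * fact (i + j) / fact (i + j - j))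
        = ((-1) ^ i * of_nat (d choose i) / fact d :: complex)" .
  qed
  also have "\<dots> = (if l = j then 1 else 0)"
    using choose_alternating_sum[of d, where 'a = complex] by (auto simp: d)
  finally show ?thesis .
qed

subsection \<open>Biorthogonality and the kernel\<close>

lemma polya_P_nat:
  "polya_P \<omega> (int l) z = (\<Sum>k\<le>l. 1 / (fact (l - k) * fact k) * ((- z) ^ k / mellin \<omega> (int k)))"
  by (simp add: polya_P_def lessThan_Suc_atMost nat_add_distrib)

lemma polya_P_pred:
  "polya_P \<omega> (int l - 1) z = (\<Sum>k<l. 1 / (fact (l - 1 - k) * fact k) * ((- z) ^ k / mellin \<omega> (int k)))"
  by (simp add: polya_P_def nat_diff_distrib')

text \<open>A trigonometric polynomial in the shape that \<open>csmooth_cis_mult\<close> and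
  \<open>fourier\<close> expect.\<close>

lemma polya_P_rotate:
  "polya_P \<omega> (int l) (z * cis t) =
     (\<Sum>k\<le>l. (1 / (fact (l - k) * fact k) * ((- z) ^ k / mellin \<omega> (int k))) * cis (of_int (int k) * t))"
proof -
  have "(- (z * cis t)) ^ k = (- z) ^ k * cis (of_int (int k) * t)" for k
  proof -
    have "(- (z * cis t)) ^ k = (- z * cis t) ^ k" by simp
    also have "\<dots> = (- z) ^ k * cis t ^ k" by (rule power_mult_distrib)
    also have "cis t ^ k = cis (real k * t)" by (rule Complex.DeMoivre)
    finally show ?thesis by (simp only: of_int_of_nat_eq)
  qed
  then show ?thesis unfolding polya_P_nat by simp
qed

lemma csmooth_P_Q:
  assumes B: "negligible B" and q: "csmooth B n q"
  shows "csmooth B n (\<lambda>t. polya_P \<omega> (int l) (z * cis t) * q t)"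
  unfolding polya_P_rotate sum_distrib_right
  by (intro csmooth_sum[OF B] csmooth_cis_mult[OF B] q)

lemma integral_P_mult:
  assumes "integrable haar_angle q"
  shows "(LINT t|haar_angle. polya_P \<omega> (int l) (z * cis t) * q t) =
     (\<Sum>k\<le>l. 1 / (fact (l - k) * fact k) * ((- z) ^ k / mellin \<omega> (int k)) * fourier q (int k))"
proof -
  let ?c = "\<lambda>k. 1 / (fact (l - k) * fact k) * ((- z) ^ k / mellin \<omega> (int k))"
  have "(LINT t|haar_angle. polya_P \<omega> (int l) (z * cis t) * q t)
      = (LINT t|haar_angle. (\<Sum>k\<le>l. ?c k * (cis (of_int (int k) * t) * q t)))"
    unfolding polya_P_rotate sum_distrib_right mult.assoc ..
  also have "\<dots> = (\<Sum>k\<le>l. (LINT t|haar_angle. ?c k * (cis (of_int (int k) * t) * q t)))"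
    by (intro Bochner_Integration.integral_sum integrable_mult_right integrable_haar_angle_cis assms)
  also have "\<dots> = (\<Sum>k\<le>l. ?c k * fourier q (int k))"
    unfolding fourier_def by (intro sum.cong refl integral_mult_right_zero)
  finally show ?thesis .
qed

context
  fixes B :: "real set" and \<omega> :: "complex \<Rightarrow> complex" and N :: nat and h :: "real \<Rightarrow> complex"
  defines "h \<equiv> \<lambda>t. \<omega> (cis t)"
  assumes B: "negligible B" and mellin_nz: "\<And>k. k < N \<Longrightarrow> mellin \<omega> (int k) \<noteq> 0"
begin

text \<open>The denominator of \<open>polya_P\<close> cancels the Fourier coefficient of the weight,
  leaving a polynomial free of \<omega>. Its value at \<open>z = 1\<close> gives biorthogonality,
  and its form for \<open>l = j\<close> the mean of the kernel.\<close>

lemma integral_P_Q: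
  assumes l: "l < N" and h: "csmooth B j h"
  shows "(LINT t|haar_angle. polya_P \<omega> (int l) (z * cis t) * Q_angle h j t)
    = (\<Sum>k\<le>l. (-1) ^ k / (fact (l - k) * fact k) * (\<Prod>m<j. of_nat m - of_nat k) * z ^ k)"
proof -
  have "integrable haar_angle (Q_angle h j)"
    by (rule csmooth_integrable[OF csmooth_Q_angle[OF B, of j 0]]) (use h in simp)
  note P = integral_P_mult[OF this]
  have "fourier (Q_angle h j) (int k) = (\<Prod>m<j. of_nat m - of_nat k) * mellin \<omega> (int k)" for k
    unfolding fourier_Q_angle[OF B h] by (simp add: mellin_eq_fourier h_def)
  then show ?thesis
    unfolding P using l mellin_nz by (intro sum.cong refl) (simp add: power_minus[of z])
qed

lemma biorthonormal:
  assumes "l < N" "csmooth B j h"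
  shows "(LINT t|haar_angle. polya_P \<omega> (int l) (cis t) * Q_angle h j t) = (if l = j then 1 else 0)"
  using integral_P_Q[OF assms, of 1] alternating_factorial_sum[of l j] by simp

text \<open>Only the term \<open>k = j\<close> survives, so \<open>z ^ k\<close> may be replaced by
  \<open>z ^ j\<close> before summing.\<close>

lemma integral_P_Q_diag:
  assumes "j < N" "csmooth B j h"
  shows "(LINT t|haar_angle. polya_P \<omega> (int j) (z * cis t) * Q_angle h j t) = z ^ j"
proof -
  have "(\<Sum>k\<le>j. (-1) ^ k / (fact (j - k) * fact k) * (\<Prod>m<j. of_nat m - of_nat k) * z ^ k)
      = (\<Sum>k\<le>j. (-1) ^ k / (fact (j - k) * fact k) * (\<Prod>m<j. of_nat m - of_nat k) * z ^ j)"
    by (intro sum.cong refl) (auto simp: prod_nat_diff)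
  also have "\<dots> = z ^ j"
    unfolding sum_distrib_right[symmetric] alternating_factorial_sum by simp
  finally show ?thesis unfolding integral_P_Q[OF assms] .
qed

end

text \<open>Differentiation weights the k-th term by k = l - (l - k), and the factor l - k lowers (l
  - k)! to (l - 1 - k)!, the denominator of the preceding polynomial.\<close>

lemma polya_P_has_vector_derivative:
  "((\<lambda>t. polya_P \<omega> (int l) (z * cis t)) has_vector_derivative
    \<i> * (of_nat l * polya_P \<omega> (int l) (z * cis t) - polya_P \<omega> (int l - 1) (z * cis t))) (at t)"
proof -
  let ?c = "\<lambda>k. 1 / (fact (l - k) * fact k) * ((- z) ^ k / mellin \<omega> (int k))"
  have "((\<lambda>t. \<Sum>k\<le>l. ?c k * cis (of_int (int k) * t) * 1) has_vector_derivative
      (\<Sum>k\<le>l. ?c k * cis (of_int (int k) * t) * (0 + \<i> * of_real (of_int (int k)) * 1))) (at t)"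
    by (intro has_vector_derivative_sum has_vector_derivative_cis_mult has_vector_derivative_const)
  moreover have "(\<Sum>k\<le>l. ?c k * cis (of_int (int k) * t) * (0 + \<i> * of_real (of_int (int k)) * 1))
      = \<i> * (of_nat l * polya_P \<omega> (int l) (z * cis t) - polya_P \<omega> (int l - 1) (z * cis t))"
  proof -
    let ?a = "\<lambda>k. (- (z * cis t)) ^ k / mellin \<omega> (int k)"
    have ca: "?c k * cis (of_int (int k) * t) = 1 / (fact (l - k) * fact k) * ?a k" for k
    proof -
      have "(- (z * cis t)) ^ k = (- z * cis t) ^ k" by simp
      also have "\<dots> = (- z) ^ k * cis t ^ k" by (rule power_mult_distrib)
      also have "cis t ^ k = cis (real k * t)" by (rule Complex.DeMoivre)
      finally show ?thesis by simp
    qed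
    have "of_nat l * polya_P \<omega> (int l) (z * cis t) - (\<Sum>k\<le>l. of_nat k * (1 / (fact (l - k) * fact k) * ?a k))
        = (\<Sum>k\<le>l. of_nat (l - k) * (1 / (fact (l - k) * fact k) * ?a k))"
      unfolding polya_P_nat sum_distrib_left sum_subtractf[symmetric]
      by (intro sum.cong refl) (simp add: of_nat_diff left_diff_distrib diff_divide_distrib)
    also have "\<dots> = (\<Sum>k<l. of_nat (l - k) * (1 / (fact (l - k) * fact k) * ?a k))"
      unfolding lessThan_Suc_atMost[symmetric] by simp
    also have "\<dots> = polya_P \<omega> (int l - 1) (z * cis t)"
      unfolding polya_P_pred
    proof (intro sum.cong refl)
      fix k assume "k \<in> {..<l}"
      then obtain d where d: "l = Suc (k + d)" by (metis lessThan_iff less_natE)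
      show "of_nat (l - k) * (1 / (fact (l - k) * fact k) * ?a k) = 1 / (fact (l - 1 - k) * fact k) * ?a k"
        unfolding d by (simp add: Suc_diff_le fact_Suc del: of_nat_Suc)
    qed
    finally have "of_nat l * polya_P \<omega> (int l) (z * cis t) - polya_P \<omega> (int l - 1) (z * cis t)
        = (\<Sum>k\<le>l. of_nat k * (1 / (fact (l - k) * fact k) * ?a k))"
      by (simp add: algebra_simps)
    then show ?thesis unfolding ca by (simp add: sum_distrib_left mult_ac)
  qed
  ultimately show ?thesis unfolding polya_P_rotate[of \<omega> l] by simp
qed

text \<open>The terms with factor j cancel. The case distinction encodes that the polynomial of
  index -1 is zero.\<close>

lemma P_Q_telescope:
  "(\<Sum>j<n. P j * (Q (Suc j) - of_nat j * Q j) + (of_nat j * P j - (if j = 0 then 0 else P (j - 1))) * Q j)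
    = (if n = 0 then 0 else P (n - 1) * Q n :: complex)"
  by (induction n) (auto simp: algebra_simps)

text \<open>Integrating \<open>\<phi> (z\<^sub>1\<partial>\<^sub>1 + z\<^sub>2\<partial>\<^sub>2) K\<^sub>n(z\<^sub>1e\<^sup>i\<^sup>\<phi>, z\<^sub>2e\<^sup>i\<^sup>\<phi>)\<close> by parts: the derivative telescopes to
  \<open>P\<^sub>n\<^sub>-\<^sub>1 Q\<^sub>n\<close>, the boundary term is \<open>K\<^sub>n(z\<^sub>1, z\<^sub>2)\<close>, and the mean of the kernel over
  simultaneous rotations is a geometric sum by biorthogonality.\<close>

lemma kernel_sum_eq:
  fixes B :: "real set" and \<omega> :: "complex \<Rightarrow> complex" and h :: "real \<Rightarrow> complex"
  defines "h \<equiv> \<lambda>t. \<omega> (cis t)"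
  assumes B: "negligible B" and h: "csmooth B n h"
    and nz: "\<And>k. k < n \<Longrightarrow> mellin \<omega> (int k) \<noteq> 0" and \<alpha>: "0 \<le> \<alpha>" "\<alpha> \<le> 2*pi"
  shows "(\<Sum>j<n. polya_P \<omega> (int j) z * Q_angle h j \<alpha>) =
    \<i> * (LINT \<phi>:{0..2*pi}|lebesgue. of_real (\<phi> / (2*pi)) * polya_P \<omega> (int n - 1) (z * cis \<phi>) * Q_angle h n (\<phi> + \<alpha>))
    + (\<Sum>k<n. (z / cis \<alpha>) ^ k)"
proof (cases n)
  case 0
  then show ?thesis by (simp add: polya_P_def set_lebesgue_integral_def)
next
  case (Suc m)
  define B' where "B' = {t. t + \<alpha> \<in> B}"
  have "(+) \<alpha> ` B' = B" by (force simp: B'_def image_iff add.commute intro: exI[of _ "_ - \<alpha>"])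
  then have B': "negligible B'" using B negligible_translation_rev[of \<alpha> B'] by simp
  let ?P = "\<lambda>j t. polya_P \<omega> (int j) (z * cis t)"
  let ?q = "\<lambda>j t. Q_angle h j (t + \<alpha>)"
  have q: "csmooth B' (n - j) (?q j)" if "j \<le> n" for j
    unfolding B'_def by (rule csmooth_shift[OF \<alpha> csmooth_Q_angle[OF B]]) (use that h in simp)
  have Bq: "csmooth B (n - j) (Q_angle h j)" if "j \<le> n" for j
    by (rule csmooth_Q_angle[OF B]) (use that h in simp)
  \<comment> \<open>The kernel with both arguments rotated by \<open>t\<close>; \<open>G 0\<close>
    is the sum to be computed.\<close>
  define G where "G t = (\<Sum>j<n. ?P j t * ?q j t)" for t
  have PQ: "csmooth B' (Suc 0) (\<lambda>t. ?P j t * ?q j t)" if "j < n" for j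
    by (rule csmooth_mono[OF csmooth_P_Q[OF B' q]]) (use that in auto)
  then have G: "csmooth B' (Suc 0) G"
    unfolding G_def by (intro csmooth_sum[OF B']) auto
  have eG: "euler_angle G t = ?P m t * ?q n t" if t: "t \<notin> B'" for t
  proof -
    have d: "(?q j has_vector_derivative \<i> * (?q (Suc j) t - of_nat j * ?q j t)) (at t)" if "j < n" for j
    proof -
      have "?q j differentiable at t"
        using csmooth_differentiable[of B' "n - Suc j" "?q j" t] q[of j] t that
        by (auto simp: exc_def Suc_diff_Suc simp del: csmooth.simps)
      from differentiable_has_euler_angle[OF this] show ?thesis
        by (simp add: euler_angle_shift euler_plus_def)
    qed
    have "(G has_vector_derivative (\<Sum>j<n. ?P j t * (\<i> * (?q (Suc j) t - of_nat j * ?q j t))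
        + \<i> * (of_nat j * ?P j t - polya_P \<omega> (int j - 1) (z * cis t)) * ?q j t)) (at t)"
      unfolding G_def
      by (intro has_vector_derivative_sum has_vector_derivative_mult polya_P_has_vector_derivative d) auto
    also have "(\<Sum>j<n. ?P j t * (\<i> * (?q (Suc j) t - of_nat j * ?q j t))
        + \<i> * (of_nat j * ?P j t - polya_P \<omega> (int j - 1) (z * cis t)) * ?q j t)
      = \<i> * (\<Sum>j<n. ?P j t * (?q (Suc j) t - of_nat j * ?q j t)
        + (of_nat j * ?P j t - (if j = 0 then 0 else ?P (j - 1) t)) * ?q j t)"
      unfolding sum_distrib_left
      by (intro sum.cong refl) (auto simp: polya_P_def of_nat_diff algebra_simps)
    also have "\<dots> = \<i> * (?P m t * ?q n t)" 
      unfolding P_Q_telescope[of "\<lambda>j. ?P j t" "\<lambda>j. ?q j t" n] by (simp add: Suc)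
    finally show ?thesis by (simp add: euler_angle_eqI mult.assoc[symmetric])
  qed
  let ?F = "\<lambda>t. of_real (t / (2*pi)) * (?P m t * ?q n t)"
  have "csmooth B' 0 (\<lambda>t. ?P m t * ?q n t)"
    using csmooth_P_Q[OF B' q[of n]] by simp
  then have i: "(\<lambda>t. ?P m t * ?q n t) absolutely_integrable_on {0..2*pi}"
    by (simp add: integrable_haar_angle_iff)
  \<comment> \<open>Integration by parts yields a gauge integral. Absolute integrability identifies
    it with the Lebesgue integral of the statement.\<close>
  have F: "?F absolutely_integrable_on {0..2*pi}"
  proof (rule absolutely_integrable_bounded_measurable_product[OF bilinear_times _ _ _ i])
    have c: "continuous_on {0..2*pi} (\<lambda>t. complex_of_real (t / (2*pi)))" by (intro continuous_intros) auto
    show "(\<lambda>t. complex_of_real (t / (2*pi))) \<in> borel_measurable (lebesgue_on {0..2*pi})"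
      by (rule continuous_imp_measurable_on_sets_lebesgue[OF c]) simp
    show "bounded ((\<lambda>t. complex_of_real (t / (2*pi))) ` {0..2*pi})"
      by (rule compact_imp_bounded[OF compact_continuous_image[OF c]]) simp
  qed simp
  have "((\<lambda>t. of_real (1 / (2*pi)) * (of_real t * euler_angle G t)) has_integral
      of_real (1 / (2*pi)) * (- \<i> * (2 * pi * G 0) + \<i> * integral {0..2*pi} G)) {0..2*pi}"
    by (intro has_integral_mult_right csmooth_by_parts[OF B' G])
  then have "(?F has_integral of_real (1 / (2*pi)) * (- \<i> * (2 * pi * G 0) + \<i> * integral {0..2*pi} G)) {0..2*pi}"
    by (rule has_integral_spike[OF B', rotated]) (simp add: eG)
  then have "(LINT t:{0..2*pi}|lebesgue. ?F t) = of_real (1 / (2*pi)) * (- \<i> * (2 * pi * G 0) + \<i> * integral {0..2*pi} G)"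
    unfolding set_lebesgue_integral_eq_integral(2)[OF F] by (rule integral_unique)
  then have 1: "\<i> * (LINT t:{0..2*pi}|lebesgue. ?F t) = G 0 - integral {0..2*pi} G / (2*pi)"
  proof -
    have "\<i> * (of_real (1 / (2*pi)) * (- \<i> * (2 * pi * g) + \<i> * I)) = g - I / (2*pi)" for g I :: complex
      by (simp add: field_simps)
    with \<open>(LINT t:{0..2*pi}|lebesgue. ?F t) = _\<close> show ?thesis by (simp only:)
  qed
  have Gi: "integrable haar_angle G" using G by (rule csmooth_integrable)
  then have "(G has_integral integral {0..2*pi} G) {0..2*pi}"
    using set_lebesgue_integral_eq_integral(1) by (auto simp: integrable_haar_angle_iff intro: integrable_integral)
  from integral_haar_angle_eq[OF Gi this]
  have 2: "integral {0..2*pi} G / (2*pi) = (LINT t|haar_angle. G t)" by simp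
  also have "\<dots> = (\<Sum>j<n. (LINT t|haar_angle. ?P j t * ?q j t))"
    unfolding G_def by (intro Bochner_Integration.integral_sum csmooth_integrable[OF PQ]) auto
  also have "\<dots> = (\<Sum>j<n. (z / cis \<alpha>) ^ j)"
  proof (intro sum.cong refl)
    fix j assume j: "j \<in> {..<n}"
    \<comment> \<open>Translating the angle by \<alpha> removes the shift from the second factor at
      the price of dividing \<open>z\<close> by \<open>cis \<alpha>\<close>.\<close>
    let ?f = "\<lambda>t. polya_P \<omega> (int j) ((z / cis \<alpha>) * cis t) * Q_angle h j t"
    have f: "csmooth B (n - j) ?f" using j by (intro csmooth_P_Q[OF B Bq]) auto
    have "(LINT t|haar_angle. ?f (t + \<alpha>)) = (LINT t|haar_angle. ?f t)"
      using csmooth_integrable[OF f] csmooth_periodic[OF f] \<alpha>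
      by (intro integral_haar_angle_shift) (auto simp: periodic2pi_def)
    also have "\<dots> = (z / cis \<alpha>) ^ j"
      using integral_P_Q_diag[OF B, of n \<omega> j "z / cis \<alpha>"] nz j csmooth_mono[OF h, of j]
      unfolding h_def by auto
    also have "(\<lambda>t. ?f (t + \<alpha>)) = (\<lambda>t. ?P j t * ?q j t)"
    proof
      fix t
      have "z / cis \<alpha> * cis (t + \<alpha>) = z * cis t" by (simp add: cis_mult[symmetric])
      then show "?f (t + \<alpha>) = ?P j t * ?q j t" by simp
    qed
    finally show "(LINT t|haar_angle. ?P j t * ?q j t) = (z / cis \<alpha>) ^ j" .
  qed
  finally show ?thesis using 1 by (simp add: Suc G_def mult.assoc)
qed

subsection \<open>Integrating out points of a biorthogonal ensemble\<close>

definition det_kernel :: "('a \<Rightarrow> 'a \<Rightarrow> complex) \<Rightarrow> nat \<Rightarrow> (nat \<Rightarrow> 'a) \<Rightarrow> complex" where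
  "det_kernel K n z = Determinant.det (Matrix.mat n n (\<lambda>(a, b). K (z a) (z b)))"

lemma det_kernel_eq:
  "det_kernel K n z = (\<Sum>\<sigma> | \<sigma> permutes {0..<n}. of_int (sign \<sigma>) * (\<Prod>a\<in>{0..<n}. K (z a) (z (\<sigma> a))))"
  unfolding det_kernel_def
  by (subst det_def'[of _ n]) (auto intro!: sum.cong prod.cong dest: permutes_in_image)

lemma det_kernel_cong:
  assumes "\<And>a. a < n \<Longrightarrow> z a = w a"
  shows "det_kernel K n z = det_kernel K n w"
  unfolding det_kernel_def using assms by (intro arg_cong[where f = Determinant.det] Matrix.eq_matI) auto

text \<open>\<open>has_bochner_integral\<close> bundles the integrability of each pairing with its
  value, so both pass together through finite sums.\<close>

locale biorthogonal_system = sigma_finite_measure M for M :: "'a measure" +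
  fixes p q :: "nat \<Rightarrow> 'a \<Rightarrow> complex" and N :: nat
  assumes biorthogonal: "i < N \<Longrightarrow> j < N \<Longrightarrow> has_bochner_integral M (\<lambda>x. p i x * q j x) (if i = j then 1 else 0)"
begin

definition K :: "'a \<Rightarrow> 'a \<Rightarrow> complex" where
  "K x y = (\<Sum>j<N. p j x * q j y)"

lemma integral_K_diag: "has_bochner_integral M (\<lambda>x. K x x) (of_nat N)"
proof -
  have "has_bochner_integral M (\<lambda>x. \<Sum>j<N. p j x * q j x) (\<Sum>j<N. if j = j then 1 else 0)"
    by (intro has_bochner_integral_sum biorthogonal) auto
  then show ?thesis by (simp add: K_def)
qed

text \<open>The reproducing property: \<open>K\<close> is the kernel of a projection, in general
  oblique.\<close>

lemma integral_K_K: "has_bochner_integral M (\<lambda>x. K x z * K y x) (K y z)"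
proof -
  have "has_bochner_integral M (\<lambda>x. \<Sum>i<N. \<Sum>j<N. (p i x * q j x) * (q i z * p j y))
      (\<Sum>i<N. \<Sum>j<N. (if i = j then 1 else 0) * (q i z * p j y))"
    by (intro has_bochner_integral_sum has_bochner_integral_mult_left biorthogonal) auto
  moreover have "(\<Sum>i<N. \<Sum>j<N. (p i x * q j x) * (q i z * p j y)) = K x z * K y x" for x
    unfolding K_def sum_product by (intro sum.cong refl) (simp add: mult_ac)
  moreover have "(\<Sum>i<N. \<Sum>j<N. (if i = j then 1 else 0) * (q i z * p j y)) = K y z"
    unfolding K_def by (intro sum.cong refl) (simp add: if_distrib[of "\<lambda>x. x * _"] sum.delta mult.commute cong: if_cong)
  ultimately show ?thesis by simp
qed

text \<open>A permutation of \<open>n + 1\<close> points either fixes the last point or passes through it; in the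
  second case integration contracts the two factors meeting there and yields a permutation of
  \<open>n\<close> points of opposite sign.\<close>

lemma integral_det_kernel_step:
  "has_bochner_integral M (\<lambda>x. det_kernel K (Suc n) (z(n := x))) ((of_nat N - of_nat n) * det_kernel K n z)"
proof -
  let ?S = "{0..<n}"
  \<comment> \<open>The trace N if the last point is fixed, and the change of sign if the
    permutation passes through it.\<close>
  define c where "c b = (if b = n then of_nat N else - 1 :: complex)" for b
  let ?t = "\<lambda>\<sigma>. of_int (sign \<sigma>) * (\<Prod>a\<in>?S. K (z a) (z (\<sigma> a)))"
  let ?T = "\<lambda>\<pi> x. of_int (sign \<pi>) * (\<Prod>a\<in>insert n ?S. K ((z(n := x)) a) ((z(n := x)) (\<pi> a)))"
  have T: "has_bochner_integral M (?T (Transposition.transpose n b \<circ> \<sigma>)) (c b * ?t \<sigma>)"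
    if b: "b \<in> insert n ?S" and \<sigma>: "\<sigma> permutes ?S" for b \<sigma>
  proof -
    have \<sigma>n: "\<sigma> n = n" using \<sigma> by (auto simp: permutes_def)
    have \<sigma>a: "\<sigma> a < n" if "a < n" for a using permutes_in_image[OF \<sigma>, of a] that by simp
    have perm: "permutation \<sigma>" using \<sigma> by (auto intro: permutation_permutes[THEN iffD2])
    show ?thesis
    proof (cases "b = n")
      case True
      have "?T (Transposition.transpose n b \<circ> \<sigma>) = (\<lambda>x. K x x * ?t \<sigma>)"
      proof
        fix x
        have "(\<Prod>a\<in>?S. K ((z(n := x)) a) ((z(n := x)) (\<sigma> a))) = (\<Prod>a\<in>?S. K (z a) (z (\<sigma> a)))"
          using \<sigma>a by (intro prod.cong refl) (metis atLeastLessThan_iff fun_upd_other less_irrefl)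
        then show "?T (Transposition.transpose n b \<circ> \<sigma>) x = K x x * ?t \<sigma>" by (simp add: True \<sigma>n)
      qed
      then show ?thesis using has_bochner_integral_mult_left[OF integral_K_diag, of "?t \<sigma>"] True by (simp add: c_def)
    next
      case False
      then have bn: "b < n" using b by auto
      \<comment> \<open>The composed permutation sends \<open>a0\<close> to \<open>n\<close> and
        \<open>n\<close> to \<open>b\<close>. The two factors containing the last point contract to
        the factor that \<sigma> has at \<open>a0\<close>.\<close>
      define a0 where "a0 = Hilbert_Choice.inv \<sigma> b"
      have a0: "a0 < n" "\<sigma> a0 = b"
        using permutes_inverses(1)[OF \<sigma>] permutes_in_image[OF permutes_inv[OF \<sigma>], of b] bn
        by (auto simp: a0_def)
      have inj: "\<sigma> a = b \<longleftrightarrow> a = a0" for a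
        using permutes_inj[OF \<sigma>] a0(2) by (auto dest: injD)
      let ?R = "\<Prod>a\<in>?S - {a0}. K (z a) (z (\<sigma> a))"
      have sgn: "sign (Transposition.transpose n b \<circ> \<sigma>) = - sign \<sigma>"
        using False perm by (subst sign_compose) (auto simp: sign_swap_id permutation_swap_id)
      have "?T (Transposition.transpose n b \<circ> \<sigma>) = (\<lambda>x. (K x (z b) * K (z a0) x) * (- of_int (sign \<sigma>) * ?R))"
      proof
        fix x
        have "(\<Prod>a\<in>?S. K ((z(n := x)) a) ((z(n := x)) ((Transposition.transpose n b \<circ> \<sigma>) a)))
            = K (z a0) x * (\<Prod>a\<in>?S - {a0}. K ((z(n := x)) a) ((z(n := x)) ((Transposition.transpose n b \<circ> \<sigma>) a)))"
          using a0 by (subst prod.remove[of _ a0]) auto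
        also have "(\<Prod>a\<in>?S - {a0}. K ((z(n := x)) a) ((z(n := x)) ((Transposition.transpose n b \<circ> \<sigma>) a))) = ?R"
        proof (rule prod.cong[OF refl])
          fix a assume "a \<in> ?S - {a0}"
          then have "a < n" "\<sigma> a \<noteq> b" "\<sigma> a \<noteq> n" "a \<noteq> n" using inj \<sigma>a[of a] by auto
          then show "K ((z(n := x)) a) ((z(n := x)) ((Transposition.transpose n b \<circ> \<sigma>) a)) = K (z a) (z (\<sigma> a))"
            by (simp add: transpose_apply_other)
        qed
        finally show "?T (Transposition.transpose n b \<circ> \<sigma>) x = (K x (z b) * K (z a0) x) * (- of_int (sign \<sigma>) * ?R)"
          using bn unfolding sgn by (simp add: \<sigma>n)
      qed
      moreover have "c b * ?t \<sigma> = K (z a0) (z b) * (- of_int (sign \<sigma>) * ?R)"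
        using a0 False by (subst prod.remove[of _ a0]) (auto simp: c_def)
      ultimately show ?thesis by (simp only:) (intro has_bochner_integral_mult_left integral_K_K)
    qed
  qed
  have "det_kernel K (Suc n) (z(n := x)) = (\<Sum>b\<in>insert n ?S. \<Sum>\<sigma> | \<sigma> permutes ?S. ?T (Transposition.transpose n b \<circ> \<sigma>) x)" for x
    unfolding det_kernel_eq atLeast0_lessThan_Suc
    by (rule sum_over_permutations_insert) auto
  moreover have "has_bochner_integral M (\<lambda>x. \<Sum>b\<in>insert n ?S. \<Sum>\<sigma> | \<sigma> permutes ?S. ?T (Transposition.transpose n b \<circ> \<sigma>) x)
      (\<Sum>b\<in>insert n ?S. \<Sum>\<sigma> | \<sigma> permutes ?S. c b * ?t \<sigma>)"
    by (intro has_bochner_integral_sum T) auto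
  moreover have "(\<Sum>b\<in>insert n ?S. \<Sum>\<sigma> | \<sigma> permutes ?S. c b * ?t \<sigma>) = (\<Sum>b\<in>insert n ?S. c b) * det_kernel K n z"
    unfolding det_kernel_eq sum_product ..
  moreover have "(\<Sum>b\<in>insert n ?S. c b) = of_nat N - of_nat n"
    by (simp add: c_def)
  ultimately show ?thesis by simp
qed

text \<open>The factors \<open>K (z a) (z (\<sigma> a))\<close> couple different points. Expanding
  every kernel and regrouping by point, after reindexing the q-factors by the inverse of \<sigma>,
  gives products of one-variable functions, each an integrable pairing.\<close>

lemma integrable_det_kernel:
  assumes kn: "k \<le> n"
  shows "integrable (PiM {k..<n} (\<lambda>_. M)) (\<lambda>\<tau>. det_kernel K n (\<lambda>i. if i < k then z i else \<tau> i))"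
proof -
  interpret P: product_sigma_finite "\<lambda>_ :: nat. M" by standard
  let ?w = "\<lambda>\<tau> i. if i < k then z i else \<tau> i"
  have "integrable (PiM {k..<n} (\<lambda>_. M)) (\<lambda>\<tau>. \<Prod>a\<in>{0..<n}. K (?w \<tau> a) (?w \<tau> (\<sigma> a)))"
    if \<sigma>: "\<sigma> permutes {0..<n}" for \<sigma>
  proof -
    have eq: "(\<Prod>a\<in>{0..<n}. K (w a) (w (\<sigma> a)))
        = (\<Sum>f\<in>{0..<n} \<rightarrow>\<^sub>E {..<N}. \<Prod>a\<in>{0..<n}. p (f a) (w a) * q (f (Hilbert_Choice.inv \<sigma> a)) (w a))" for w
    proof -
      have "(\<Prod>a\<in>{0..<n}. K (w a) (w (\<sigma> a)))
          = (\<Sum>f\<in>{0..<n} \<rightarrow>\<^sub>E {..<N}. \<Prod>a\<in>{0..<n}. p (f a) (w a) * q (f a) (w (\<sigma> a)))"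
        unfolding K_def by (rule prod_sum_PiE) auto
      also have "\<dots> = (\<Sum>f\<in>{0..<n} \<rightarrow>\<^sub>E {..<N}. \<Prod>a\<in>{0..<n}. p (f a) (w a) * q (f (Hilbert_Choice.inv \<sigma> a)) (w a))"
      proof (intro sum.cong refl)
        fix f
        have "(\<Prod>a\<in>{0..<n}. q (f (Hilbert_Choice.inv \<sigma> a)) (w a)) = (\<Prod>a\<in>{0..<n}. q (f (Hilbert_Choice.inv \<sigma> (\<sigma> a))) (w (\<sigma> a)))"
          using prod.permute[OF \<sigma>, of "\<lambda>a. q (f (Hilbert_Choice.inv \<sigma> a)) (w a)"] by (simp add: comp_def)
        then show "(\<Prod>a\<in>{0..<n}. p (f a) (w a) * q (f a) (w (\<sigma> a)))
            = (\<Prod>a\<in>{0..<n}. p (f a) (w a) * q (f (Hilbert_Choice.inv \<sigma> a)) (w a))"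
          by (simp add: prod.distrib permutes_inverses(2)[OF \<sigma>])
      qed
      finally show ?thesis .
    qed
    have "integrable (PiM {k..<n} (\<lambda>_. M)) (\<lambda>\<tau>. \<Sum>f\<in>{0..<n} \<rightarrow>\<^sub>E {..<N}.
        \<Prod>a\<in>{0..<n}. p (f a) (?w \<tau> a) * q (f (Hilbert_Choice.inv \<sigma> a)) (?w \<tau> a))"
    proof (rule Bochner_Integration.integrable_sum)
      fix f assume f: "f \<in> {0..<n} \<rightarrow>\<^sub>E {..<N}"
      let ?g = "\<lambda>a x. p (f a) x * q (f (Hilbert_Choice.inv \<sigma> a)) x"
      have un: "{0..<n} = {0..<k} \<union> {k..<n}" using kn by auto
      have "(\<Prod>a\<in>{0..<n}. ?g a (?w \<tau> a)) = (\<Prod>a\<in>{0..<k}. ?g a (z a)) * (\<Prod>a\<in>{k..<n}. ?g a (\<tau> a))" for \<tau>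
        unfolding un by (subst prod.union_disjoint) (auto intro!: arg_cong2[where f = "(*)"] prod.cong)
      moreover have "integrable (PiM {k..<n} (\<lambda>_. M)) (\<lambda>\<tau>. \<Prod>a\<in>{k..<n}. ?g a (\<tau> a))"
      proof (rule P.product_integrable_prod)
        fix a assume a: "a \<in> {k..<n}"
        then have "Hilbert_Choice.inv \<sigma> a \<in> {0..<n}" using permutes_in_image[OF permutes_inv[OF \<sigma>], of a] by simp
        then have "f a < N" "f (Hilbert_Choice.inv \<sigma> a) < N" using f a by (auto simp: PiE_iff)
        then show "integrable M (?g a)" by (rule integrable.intros[OF biorthogonal])
      qed simp
      ultimately show "integrable (PiM {k..<n} (\<lambda>_. M)) (\<lambda>\<tau>. \<Prod>a\<in>{0..<n}. ?g a (?w \<tau> a))"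
        by (simp add: integrable_mult_right)
    qed
    moreover have "(\<Prod>a\<in>{0..<n}. K (?w \<tau> a) (?w \<tau> (\<sigma> a))) = (\<Sum>f\<in>{0..<n} \<rightarrow>\<^sub>E {..<N}.
        \<Prod>a\<in>{0..<n}. p (f a) (?w \<tau> a) * q (f (Hilbert_Choice.inv \<sigma> a)) (?w \<tau> a))" for \<tau>
      by (rule eq)
    ultimately show ?thesis by (simp only:)
  qed
  then show ?thesis
    unfolding det_kernel_eq by (intro Bochner_Integration.integrable_sum integrable_mult_right) auto
qed

lemma integral_det_kernel:
  assumes "k \<le> n"
  shows "(LINT \<tau>|PiM {k..<n} (\<lambda>_. M). det_kernel K n (\<lambda>i. if i < k then z i else \<tau> i))
    = (\<Prod>m\<in>{k..<n}. of_nat N - of_nat m) * det_kernel K k z"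
proof -
  interpret P: product_sigma_finite "\<lambda>_ :: nat. M" by standard
  show ?thesis
    using assms
  proof (induction n rule: dec_induct)
    case base
    \<comment> \<open>The empty product space has a single point, with value
      \<open>undefined\<close> everywhere.\<close>
    have "det_kernel K k (\<lambda>i. if i < k then z i else undefined) = det_kernel K k z"
      by (rule det_kernel_cong) simp
    then show ?case by (simp add: PiM_empty lebesgue_integral_count_space_finite)
  next
    case (step n)
    have ins: "{k..<Suc n} = insert n {k..<n}" using step by auto
    have upd: "(\<lambda>i. if i < k then z i else (x(n := y)) i) = (\<lambda>i. if i < k then z i else x i)(n := y)" for x y
      using step by auto
    have i: "integrable (PiM (insert n {k..<n}) (\<lambda>_. M)) (\<lambda>\<tau>. det_kernel K (Suc n) (\<lambda>i. if i < k then z i else \<tau> i))"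
      using integrable_det_kernel[of k "Suc n" z] step unfolding ins by simp
    have "(LINT \<tau>|PiM {k..<Suc n} (\<lambda>_. M). det_kernel K (Suc n) (\<lambda>i. if i < k then z i else \<tau> i))
        = (LINT \<tau>|PiM {k..<n} (\<lambda>_. M). (LINT y|M. det_kernel K (Suc n) ((\<lambda>i. if i < k then z i else \<tau> i)(n := y))))"
      unfolding ins by (subst P.product_integral_insert[OF _ _ i]) (simp_all only: upd finite_atLeastLessThan atLeastLessThan_iff, simp)
    also have "\<dots> = (LINT \<tau>|PiM {k..<n} (\<lambda>_. M). (of_nat N - of_nat n) * det_kernel K n (\<lambda>i. if i < k then z i else \<tau> i))"
      by (intro Bochner_Integration.integral_cong refl has_bochner_integral_integral_eq integral_det_kernel_step)
    also have "\<dots> = (of_nat N - of_nat n) * ((\<Prod>m\<in>{k..<n}. of_nat N - of_nat m) * det_kernel K k z)"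
      by (simp add: step.IH)
    finally show ?case using step by (simp add: prod.atLeastLessThan_Suc mult_ac)
  qed
qed

lemma integral_det_kernel_all:
  assumes "k \<le> N"
  shows "(LINT \<tau>|PiM {k..<N} (\<lambda>_. M). det_kernel K N (\<lambda>i. if i < k then z i else \<tau> i))
    = fact (N - k) * det_kernel K k z"
proof -
  have "(\<Prod>m\<in>{k..<N}. of_nat N - of_nat m) = (\<Prod>m\<in>{k..<N}. of_nat (N - m) :: complex)"
    by (intro prod.cong refl) (simp add: of_nat_diff)
  also have "\<dots> = (\<Prod>i\<in>{1..N - k}. of_nat i)"
    by (rule prod.reindex_bij_witness[of _ "\<lambda>i. N - i" "\<lambda>m. N - m"]) (use assms in auto)
  also have "\<dots> = fact (N - k)" by (simp add: fact_prod)
  finally show ?thesis using integral_det_kernel[OF assms] by simp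
qed

end

subsection \<open>Determinants\<close>

lemma prod_list_diag_mat:
  "prod_list (diag_mat (Matrix.mat n n (\<lambda>(a, b). f a b))) = (\<Prod>j<n. f j j :: complex)"
proof -
  have "diag_mat (Matrix.mat n n (\<lambda>(a, b). f a b)) = map (\<lambda>j. f j j) [0..<n]"
    by (auto simp: diag_mat_def)
  then show ?thesis by (simp add: prod.distinct_set_conv_list[symmetric] atLeast0LessThan)
qed

text \<open>Used three times: for the Newton basis, for the polynomials P, and for the functions
  Q.\<close>

lemma det_triangular_transform:
  fixes X Y C :: "nat \<Rightarrow> nat \<Rightarrow> complex"
  assumes Y: "\<And>a j. a < n \<Longrightarrow> j < n \<Longrightarrow> Y a j = (\<Sum>k<n. X a k * C k j)"
    and C: "\<And>k j. j < k \<Longrightarrow> k < n \<Longrightarrow> C k j = 0"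
  shows "Determinant.det (Matrix.mat n n (\<lambda>(a, j). Y a j))
    = Determinant.det (Matrix.mat n n (\<lambda>(a, k). X a k)) * (\<Prod>j<n. C j j)"
proof -
  let ?X = "Matrix.mat n n (\<lambda>(a, k). X a k)" and ?C = "Matrix.mat n n (\<lambda>(k, j). C k j)"
  have "Matrix.mat n n (\<lambda>(a, j). Y a j) = ?X * ?C"
    by (rule eq_matI) (auto simp: Y scalar_prod_def atLeast0LessThan)
  moreover have "Determinant.det ?C = prod_list (diag_mat ?C)"
    by (rule det_upper_triangular[of _ n]) (auto simp: upper_triangular_def C)
  ultimately show ?thesis
    by (simp add: det_mult[of _ n] prod_list_diag_mat)
qed

lemma newton_poly:
  fixes z :: "nat \<Rightarrow> complex"
  shows "degree (\<Prod>m<k. [:- z m, 1:]) = k" "coeff (\<Prod>m<k. [:- z m, 1:]) k = 1"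
proof -
  have "degree (\<Prod>m<k. [:- z m, 1:]) = k \<and> coeff (\<Prod>m<k. [:- z m, 1:]) k = 1"
  proof (induction k)
    case (Suc k)
    let ?p = "\<Prod>m<k. [:- z m, 1:]"
    have "?p \<noteq> 0" by auto
    then have d: "degree (?p * [:- z k, 1:]) = Suc k" using Suc by (subst degree_mult_eq) auto
    moreover have "lead_coeff (?p * [:- z k, 1:]) = 1" using Suc by (simp add: lead_coeff_mult del: mult_pCons_right)
    ultimately show ?case by (simp del: mult_pCons_right)
  qed simp
  then show "degree (\<Prod>m<k. [:- z m, 1:]) = k" "coeff (\<Prod>m<k. [:- z m, 1:]) k = 1" by auto
qed

text \<open>The Newton basis turns the Vandermonde matrix into a lower triangular one.\<close>

lemma det_vandermonde:
  "Determinant.det (Matrix.mat n n (\<lambda>(a, k). z a ^ k)) = vandermonde n z"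
proof -
  define P where "P k = (\<Prod>m<k. [:- z m, 1:])" for k
  let ?Y = "Matrix.mat n n (\<lambda>(a, k). poly (P k) (z a))"
  have "Determinant.det ?Y = Determinant.det (Matrix.mat n n (\<lambda>(a, k). z a ^ k)) * (\<Prod>j<n. coeff (P j) j)"
  proof (rule det_triangular_transform[where C = "\<lambda>k j. coeff (P j) k"])
    show "poly (P j) (z a) = (\<Sum>k<n. z a ^ k * coeff (P j) k)" if "j < n" for a j
    proof -
      have "poly (P j) (z a) = (\<Sum>k\<le>j. coeff (P j) k * z a ^ k)"
        unfolding poly_altdef P_def newton_poly(1) ..
      also have "\<dots> = (\<Sum>k<n. coeff (P j) k * z a ^ k)"
        using that by (intro sum.mono_neutral_left) (auto simp: P_def newton_poly(1) coeff_eq_0)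
      finally show ?thesis by (simp add: mult.commute)
    qed
    show "coeff (P j) k = 0" if "j < k" for k j
      using that by (simp add: P_def newton_poly(1) coeff_eq_0)
  qed
  moreover have "(\<Prod>j<n. coeff (P j) j) = 1" by (simp add: P_def newton_poly(2))
  \<comment> \<open>\<open>P k\<close> vanishes at \<open>z a\<close> for \<open>a < k\<close>, and
    its values at \<open>z k\<close> are the factors of the Vandermonde product.\<close>
  moreover have "Determinant.det ?Y = prod_list (diag_mat ?Y)"
    by (rule det_lower_triangular[of n]) (auto simp: P_def poly_prod)
  moreover have "prod_list (diag_mat ?Y) = vandermonde n z"
    unfolding prod_list_diag_mat vandermonde_def P_def by (simp add: poly_prod)
  ultimately show ?thesis by simp
qed

subsection \<open>The density\<close>

definition neg_euler_angle :: "(real \<Rightarrow> complex) \<Rightarrow> real \<Rightarrow> complex" where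
  "neg_euler_angle h t = - euler_angle h t"

lemma neg_euler_funpow_cis:
  "((\<lambda>f u. - euler f u) ^^ b) \<omega> (cis t) = (neg_euler_angle ^^ b) (\<lambda>t. \<omega> (cis t)) t"
proof (induction b arbitrary: t)
  case (Suc b)
  then have "(\<lambda>t. ((\<lambda>f u. - euler f u) ^^ b) \<omega> (cis t)) = (neg_euler_angle ^^ b) (\<lambda>t. \<omega> (cis t))" by auto
  then show ?case by (simp only: funpow.simps comp_apply euler_cis) (simp only: neg_euler_angle_def[of _ t])
qed simp

lemma csmooth_neg_euler_funpow:
  assumes B: "negligible B"
  shows "csmooth B (b + n) h \<Longrightarrow> csmooth B n ((neg_euler_angle ^^ b) h)"
proof (induction b arbitrary: n)
  case (Suc b)
  have "csmooth B (Suc n) ((neg_euler_angle ^^ b) h)"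
    by (rule Suc.IH) (use Suc.prems in \<open>simp del: csmooth.simps\<close>)
  then have "csmooth B n (\<lambda>t. (- 1) * euler_angle ((neg_euler_angle ^^ b) h) t)"
    by (intro csmooth_cmult[OF B]) simp
  then show ?case by (simp add: neg_euler_angle_def[abs_def])
qed simp

text \<open>The coefficient of \<open>y^b\<close> in \<open>(0 - y) (1 - y) ... (j - 1 - y)\<close>,
  with y standing for \<open>- z\<partial>\<close>: an unsigned Stirling number of the first kind
  times (-1)^b.\<close>

primrec Q_coeff :: "nat \<Rightarrow> nat \<Rightarrow> complex" where
  "Q_coeff 0 b = (if b = 0 then 1 else 0)"
| "Q_coeff (Suc j) b = of_nat j * Q_coeff j b - (if b = 0 then 0 else Q_coeff j (b - 1))"

lemma Q_coeff_zero: "j < b \<Longrightarrow> Q_coeff j b = 0"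
  by (induction j arbitrary: b) auto

lemma Q_coeff_diag: "Q_coeff j j = (- 1) ^ j"
  by (induction j) (auto simp: Q_coeff_zero)

lemma Q_angle_expand:
  assumes B: "negligible B"
  shows "csmooth B (j + n) h \<Longrightarrow> t \<notin> exc B n \<Longrightarrow>
    Q_angle h j t = (\<Sum>b<Suc j. Q_coeff j b * (neg_euler_angle ^^ b) h t)"
proof (induction j arbitrary: n t)
  case (Suc j)
  let ?X = "\<lambda>b. (neg_euler_angle ^^ b) h"
  have Q: "Q_angle h j = (\<lambda>t. \<Sum>b<Suc j. Q_coeff j b * ?X b t)"
    by (intro ext Suc.IH[where n = "Suc n"]) (use Suc.prems in \<open>simp_all add: exc_def del: csmooth.simps\<close>)
  have d: "(?X b has_vector_derivative (\<i> * euler_angle (?X b) t)) (at t)" if "b < Suc j" for b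
  proof -
    have "csmooth B (Suc (j - b + n)) (?X b)"
      by (rule csmooth_neg_euler_funpow[OF B]) (use Suc.prems(1) that in \<open>simp del: csmooth.simps\<close>)
    then show ?thesis
      by (rule differentiable_has_euler_angle[OF csmooth_differentiable])
         (use Suc.prems(2) in \<open>auto simp: exc_def split: if_splits\<close>)
  qed
  have "(Q_angle h j has_vector_derivative (\<Sum>b<Suc j. Q_coeff j b * (\<i> * euler_angle (?X b) t))) (at t)"
    unfolding Q by (intro has_vector_derivative_sum has_vector_derivative_mult_right d) auto
  also have "(\<Sum>b<Suc j. Q_coeff j b * (\<i> * euler_angle (?X b) t))
      = \<i> * (\<Sum>b<Suc j. Q_coeff j b * euler_angle (?X b) t)"
    unfolding sum_distrib_left by (intro sum.cong refl) (rule mult.left_commute)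
  finally have "euler_angle (Q_angle h j) t = (\<Sum>b<Suc j. Q_coeff j b * euler_angle (?X b) t)"
    by (simp add: euler_angle_eqI mult.assoc[symmetric] del: sum.lessThan_Suc)
  also have "\<dots> = - (\<Sum>b<Suc j. Q_coeff j b * ?X (Suc b) t)"
    by (simp add: neg_euler_angle_def sum_negf)
  also have "(\<Sum>b<Suc j. Q_coeff j b * ?X (Suc b) t)
      = (\<Sum>b<Suc (Suc j). (if b = 0 then 0 else Q_coeff j (b - 1)) * ?X b t)"
    by (subst sum.lessThan_Suc_shift[of _ "Suc j"]) simp
  finally have "Q_angle h (Suc j) t = of_nat j * (\<Sum>b<Suc j. Q_coeff j b * ?X b t)
      - (\<Sum>b<Suc (Suc j). (if b = 0 then 0 else Q_coeff j (b - 1)) * ?X b t)"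
    by (simp add: euler_plus_def Q)
  also have "(\<Sum>b<Suc j. Q_coeff j b * ?X b t) = (\<Sum>b<Suc (Suc j). Q_coeff j b * ?X b t)"
    by (simp add: Q_coeff_zero)
  finally show ?case
    by (simp only: sum_distrib_left sum_subtractf[symmetric] Q_coeff.simps left_diff_distrib mult.assoc)
qed (simp add: exc_def)

text \<open>The kernel matrix factors into the P-matrix and the transposed Q-matrix. Each is a
  triangular transform of one determinant in the density, and the diagonal entries supply the
  normalisation.\<close>

lemma polya_density_eq:
  fixes \<omega> :: "complex \<Rightarrow> complex" and h :: "real \<Rightarrow> complex"
  defines "h \<equiv> \<lambda>t. \<omega> (cis t)"
  assumes B: "negligible B" and h: "csmooth B (N - 1) h"
    and nz: "\<And>k. k < N \<Longrightarrow> mellin \<omega> (int k) \<noteq> 0" and t: "\<And>i. i < N \<Longrightarrow> t i \<notin> B"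
  shows "polya_density N \<omega> (\<lambda>i. cis (t i)) =
    det_kernel (\<lambda>x y. \<Sum>j<N. polya_P \<omega> (int j) (cis x) * Q_angle h j y) N t / fact N"
proof -
  let ?X = "Matrix.mat N N (\<lambda>(a, b). (neg_euler_angle ^^ b) h (t a))"
  let ?P = "Matrix.mat N N (\<lambda>(a, j). polya_P \<omega> (int j) (cis (t a)))"
  let ?Q = "Matrix.mat N N (\<lambda>(a, j). Q_angle h j (t a))"
  let ?c = "\<lambda>k j. if k \<le> j then (-1) ^ k / (fact (j - k) * fact k * mellin \<omega> (int k)) else 0"
  have Q: "Determinant.det ?Q = Determinant.det ?X * (\<Prod>j<N. Q_coeff j j)"
  proof (rule det_triangular_transform[where C = "\<lambda>b j. Q_coeff j b"])
    fix a j assume a: "a < N" and j: "j < N"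
    have "Q_angle h j (t a) = (\<Sum>b<Suc j. Q_coeff j b * (neg_euler_angle ^^ b) h (t a))"
      by (rule Q_angle_expand[OF B, of _ "N - 1 - j"])
         (use h j t[OF a] in \<open>auto simp: exc_def simp del: csmooth.simps\<close>)
    also have "\<dots> = (\<Sum>b<N. Q_coeff j b * (neg_euler_angle ^^ b) h (t a))"
      using j by (intro sum.mono_neutral_left) (auto simp: Q_coeff_zero)
    finally show "Q_angle h j (t a) = (\<Sum>b<N. (neg_euler_angle ^^ b) h (t a) * Q_coeff j b)"
      by (simp add: mult.commute)
  qed (simp add: Q_coeff_zero)
  have "Determinant.det ?P = Determinant.det (Matrix.mat N N (\<lambda>(a, k). cis (t a) ^ k)) * (\<Prod>j<N. ?c j j)"
  proof (rule det_triangular_transform[where C = ?c])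
    fix a j assume j: "j < N"
    have "polya_P \<omega> (int j) (cis (t a)) = (\<Sum>k\<le>j. cis (t a) ^ k * ?c k j)"
      unfolding polya_P_nat by (intro sum.cong refl) (simp add: power_minus[of "cis _"] mult_ac)
    also have "\<dots> = (\<Sum>k<N. cis (t a) ^ k * ?c k j)"
      using j by (intro sum.mono_neutral_left) auto
    finally show "polya_P \<omega> (int j) (cis (t a)) = (\<Sum>k<N. cis (t a) ^ k * ?c k j)" .
  qed simp
  then have P: "Determinant.det ?P = vandermonde N (\<lambda>i. cis (t i)) * (\<Prod>j<N. ?c j j)"
    by (simp add: det_vandermonde)
  have "Matrix.mat N N (\<lambda>(a, b). \<Sum>j<N. polya_P \<omega> (int j) (cis (t a)) * Q_angle h j (t b)) = ?P * transpose_mat ?Q"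
    by (rule eq_matI) (auto simp: scalar_prod_def atLeast0LessThan)
  then have "det_kernel (\<lambda>x y. \<Sum>j<N. polya_P \<omega> (int j) (cis x) * Q_angle h j y) N t
      = Determinant.det ?P * Determinant.det ?Q"
    unfolding det_kernel_def by (simp add: det_mult[of _ N] det_transpose[of _ N])
  also have "\<dots> = vandermonde N (\<lambda>i. cis (t i)) * Determinant.det ?X * (\<Prod>j<N. ?c j j * Q_coeff j j)"
    unfolding P Q prod.distrib by (simp add: mult_ac)
  \<comment> \<open>The signs of the leading coefficients of P and Q cancel.\<close>
  also have "(\<Prod>j<N. ?c j j * Q_coeff j j) = (\<Prod>j<N. 1 / (fact j * mellin \<omega> (int j)))"
    by (intro prod.cong refl) (simp add: Q_coeff_diag)
  also have "\<dots> = 1 / (\<Prod>j<N. fact j * mellin \<omega> (int j))" by (simp add: prod_dividef)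
  finally show ?thesis
    by (simp add: polya_density_def neg_euler_funpow_cis h_def)
qed

text \<open>A product measure need not be complete, so measurability cannot be inferred from
  agreement almost everywhere with the kernel determinant and is shown from the definition of the
  density.\<close>

lemma polya_density_measurable:
  fixes \<omega> :: "complex \<Rightarrow> complex" and h :: "real \<Rightarrow> complex"
  defines "h \<equiv> \<lambda>t. \<omega> (cis t)"
  assumes B: "negligible B" and h: "csmooth B (N - 1) h"
    and w: "\<And>i. i < N \<Longrightarrow> (\<lambda>\<tau>. w \<tau> i) \<in> M \<rightarrow>\<^sub>M haar_angle"
  shows "(\<lambda>\<tau>. polya_density N \<omega> (\<lambda>i. cis (w \<tau> i))) \<in> borel_measurable M"
proof -
  have c: "(\<lambda>\<tau>. cis (w \<tau> i)) \<in> borel_measurable M" if "i < N" for i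
  proof (rule measurable_compose[OF w[OF that]])
    have "continuous_on UNIV cis" by (intro continuous_intros)
    then show "cis \<in> borel_measurable haar_angle"
      unfolding measurable_haar_angle by (rule continuous_imp_borel_measurable_lebesgue)
  qed
  have d: "(\<lambda>\<tau>. (neg_euler_angle ^^ b) h (w \<tau> i)) \<in> borel_measurable M" if "i < N" "b < N" for i b
  proof (rule measurable_compose[OF w[OF that(1)]])
    have "csmooth B (N - 1 - b) ((neg_euler_angle ^^ b) h)"
      by (rule csmooth_neg_euler_funpow[OF B]) (use h that in \<open>simp del: csmooth.simps\<close>)
    then show "(neg_euler_angle ^^ b) h \<in> borel_measurable haar_angle"
      by (intro borel_measurable_integrable csmooth_integrable)
  qed
  have "(\<lambda>\<tau>. Determinant.det (Matrix.mat N N (\<lambda>(a, b). (neg_euler_angle ^^ b) h (w \<tau> a)))) \<in> borel_measurable M"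
  proof -
    have eq: "Determinant.det (Matrix.mat N N (\<lambda>(a, b). (neg_euler_angle ^^ b) h (w \<tau> a)))
        = (\<Sum>\<sigma> | \<sigma> permutes {0..<N}. of_int (sign \<sigma>) * (\<Prod>a\<in>{0..<N}. (neg_euler_angle ^^ (\<sigma> a)) h (w \<tau> a)))" for \<tau>
      by (subst det_def'[of _ N]) (auto intro!: sum.cong prod.cong dest: permutes_in_image)
    show ?thesis unfolding eq
      by (intro borel_measurable_sum borel_measurable_times borel_measurable_const borel_measurable_prod d)
         (auto dest: permutes_in_image)
  qed
  moreover have "(\<lambda>\<tau>. vandermonde N (\<lambda>i. cis (w \<tau> i))) \<in> borel_measurable M"
    unfolding vandermonde_def by (intro borel_measurable_prod borel_measurable_diff c) auto
  ultimately show ?thesis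
    unfolding polya_density_def neg_euler_funpow_cis h_def[symmetric]
    by (intro borel_measurable_times borel_measurable_const)
qed

subsection \<open>Regularity of the weight\<close>

lemma negligible_translate_preimage:
  fixes B :: "real set"
  assumes "negligible B"
  shows "negligible {t. t + c \<in> B}"
proof -
  have "{t. t + c \<in> B} = (+) (- c) ` B" by (force simp: image_iff)
  then show ?thesis using negligible_translation[OF assms, of "- c"] by simp
qed

text \<open>\<open>haar_angle\<close> sees one period only; countably many translates of a null set
  cover the rest.\<close>

lemma negligible_periodic:
  assumes ae: "AE t in haar_angle. t \<notin> B" and per: "\<And>t. t + 2*pi \<in> B \<longleftrightarrow> t \<in> B"
  shows "negligible B"
proof -
  obtain A where A: "negligible A" "{t. \<not> (t \<in> {0..<2*pi} \<longrightarrow> t \<notin> B)} \<subseteq> A"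
    using ae unfolding AE_haar_angle_iff eventually_ae_filter_negligible by auto
  have nat: "t + 2*pi * real n \<in> B \<longleftrightarrow> t \<in> B" for t n
  proof (induction n)
    case (Suc n)
    have "t + 2*pi * real (Suc n) = (t + 2*pi * real n) + 2*pi" by (simp add: algebra_simps)
    then show ?case using per Suc by metis
  qed simp
  have int: "t - 2*pi * of_int k \<in> B" if "t \<in> B" for t k
  proof (cases "k \<ge> 0")
    case True
    then show ?thesis using nat[of "t - 2*pi * of_int k" "nat k"] that by simp
  next
    case False
    then show ?thesis using nat[of t "nat (- k)"] that by simp
  qed
  have "B \<subseteq> (\<Union>k\<in>(UNIV :: int set). (+) (2*pi * of_int k) ` A)"
  proof
    fix t assume t: "t \<in> B"
    define k where "k = \<lfloor>t / (2*pi)\<rfloor>"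
    have "of_int k \<le> t / (2*pi)" "t / (2*pi) < of_int k + 1" unfolding k_def by linarith+
    then have "t - 2*pi * of_int k \<in> {0..<2*pi}" by (simp add: field_simps)
    then have "t - 2*pi * of_int k \<in> A" using A(2) int[OF t, of k] by auto
    then have "t \<in> (+) (2*pi * of_int k) ` A" by (rule rev_image_eqI) simp
    then show "t \<in> (\<Union>k\<in>(UNIV :: int set). (+) (2*pi * of_int k) ` A)" by blast
  qed
  moreover have "negligible (\<Union>k\<in>(UNIV :: int set). (+) (2*pi * of_int k) ` A)"
    by (rule negligible_countable_Union) (auto intro: negligible_translation A)
  ultimately show ?thesis by (rule negligible_subset[rotated])
qed

text \<open>Written with the factors 1 so that \<open>csmooth_cis_mult\<close> applies
  verbatim.\<close>

lemma euler_angle_eq_cderiv: "euler_angle (\<lambda>t. f (cis t)) t = 1 * cis (of_int 1 * t) * cderiv f (cis t)"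
  by (simp add: cderiv_cis cderiv_angle_def cis_mult mult.assoc[symmetric])

lemma continuous_on_circle_angle:
  "continuous_on (sphere 0 1) f \<Longrightarrow> continuous_on UNIV (\<lambda>t. f (cis t))"
  by (rule continuous_on_compose2[where f = cis]) (auto intro!: continuous_intros)

text \<open>The hypotheses speak of powers of \<partial>, the class of powers of
  \<open>z\<partial>\<close>; one multiplication by z per order mediates, and the induction passes
  from \<open>f\<close> to \<open>cderiv f\<close>. Order 1 is separate because only there is the
  derivative missing on a null set.\<close>

lemma times_differentiable_imp_csmooth:
  assumes "times_differentiable n f" "\<And>j. j \<le> n \<Longrightarrow> deriv_in_L1 j f"
  shows "\<exists>B. negligible B \<and> csmooth B n (\<lambda>t. f (cis t))"
  using assms
proof (induction n arbitrary: f)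
  case 0
  have "csmooth {} 0 (\<lambda>t. f (cis t))"
    using 0(2)[of 0] by (simp add: deriv_in_L1_def L1_circle_def periodic2pi_circle)
  then show ?case by blast
next
  case (Suc n)
  let ?h = "\<lambda>t. f (cis t)"
  show ?case
  proof (cases n)
    case 0
    \<comment> \<open>The non-differentiability set is periodic, so being null on one period makes
      it negligible.\<close>
    define B where "B = {t. \<not> ?h differentiable at t}"
    have L1: "AE \<theta> in haar_angle. cdifferentiable f (cis \<theta>)" "integrable haar_angle (\<lambda>t. cderiv f (cis t))"
      using Suc.prems(2)[of 1] 0 by (auto simp: deriv_in_L1_def L1_circle_def)
    have "negligible B"
      by (rule negligible_periodic)
         (use L1(1) in \<open>auto simp: B_def cdifferentiable_cis periodic2pi_differentiable_iff[OF periodic2pi_circle]\<close>)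
    moreover have "integrable haar_angle (euler_angle ?h)"
      using integrable_haar_angle_cis[OF L1(2), of 1] unfolding euler_angle_eq_cderiv[abs_def] by simp
    then have "csmooth B (Suc 0) ?h"
      using Suc.prems(1) 0
      by (auto simp: times_differentiable_def periodic2pi_circle exc_def B_def ac_on_def abs_continuous_circle_def
          intro: continuous_on_circle_angle periodic2pi_euler_angle)
    ultimately show ?thesis using 0 by blast
  next
    case (Suc m)
    have td: "\<And>j z. j < Suc m \<Longrightarrow> z \<in> sphere 0 1 \<Longrightarrow> cdifferentiable ((cderiv ^^ j) f) z"
      "continuous_on (sphere 0 1) ((cderiv ^^ Suc m) f)" "abs_continuous_circle ((cderiv ^^ Suc m) f)"
      using Suc.prems(1) Suc by (auto simp: times_differentiable_def)
    have "times_differentiable n (cderiv f)"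
    proof -
      have sw: "(cderiv ^^ k) (cderiv f) = (cderiv ^^ Suc k) f" for k by (simp add: funpow_swap1)
      have "cdifferentiable ((cderiv ^^ Suc j) f) z" if "j < m" "z \<in> sphere 0 1" for j z
        using td(1)[of "Suc j" z] that by simp
      then show ?thesis
        using td(2,3) Suc unfolding times_differentiable_def sw by (simp del: funpow.simps)
    qed
    moreover have "deriv_in_L1 j (cderiv f)" if "j \<le> n" for j
      using Suc.prems(2)[of "Suc j"] Suc.prems(2)[of 1] that
      by (cases j) (auto simp: deriv_in_L1_def funpow_swap1)
    ultimately obtain B where B: "negligible B" "csmooth B n (\<lambda>t. cderiv f (cis t))"
      using Suc.IH by blast
    have e: "csmooth B n (euler_angle ?h)"
      using csmooth_cis_mult[OF B, of 1 1] unfolding euler_angle_eq_cderiv[abs_def] .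
    have d: "?h differentiable at t" for t
      using td(1)[of 0 "cis t"] by (simp add: cdifferentiable_cis)
    have hv: "(?h has_vector_derivative (\<i> * euler_angle ?h t)) (at t)" for t
      by (rule differentiable_has_euler_angle[OF d])
    \<comment> \<open>Absolute continuity is assumed for the last continuous derivative only; for
      lower orders it follows from a continuous derivative.\<close>
    have "continuous_on UNIV (\<lambda>t. \<i> * euler_angle ?h t)"
      using e Suc by (auto intro!: continuous_intros)
    then have "ac_on 0 (2*pi) ?h" by (rule ac_on_C1[OF hv])
    moreover have "continuous_on UNIV ?h"
      using hv by (auto intro!: continuous_at_imp_continuous_on has_vector_derivative_continuous)
    ultimately have "csmooth B (Suc n) ?h"
      using e d by (simp add: periodic2pi_circle)
    then show ?thesis using B by blast
  qed
qed

section \<open>The correlation kernel and its two integral formulas\<close>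

theorem corollary20:
  fixes N :: nat and \<omega> :: "complex \<Rightarrow> complex"
  assumes "N \<ge> 1"
    and "cyclic_polya_weight N \<omega>"
  shows "correlation_kernel N (polya_density N \<omega>) (polya_kernel N \<omega>) \<and>
    (AE \<theta> in haar_angle. \<forall>z1\<in>sphere 0 1. \<forall>z2. z2 = cis \<theta> \<longrightarrow>
       polya_kernel N \<omega> z1 z2 =
         polya_P \<omega> (int N - 1) z1 * polya_Q \<omega> (N - 1) z2
         + \<i> * (LINT \<phi>:{0..2 * pi}|lebesgue.
             complex_of_real (\<phi> / (2 * pi)) *
             polya_P \<omega> (int N - 2) (z1 * cis \<phi>) * polya_Q \<omega> (N - 1) (z2 * cis \<phi>))
         + (\<Sum>k<N - 1. (z1 / z2) ^ k)) \<and>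
    (times_differentiable N \<omega> \<and> (\<forall>j\<le>N. deriv_in_L1 j \<omega>) \<longrightarrow>
      (AE \<theta> in haar_angle. \<forall>z1\<in>sphere 0 1. \<forall>z2. z2 = cis \<theta> \<longrightarrow>
         polya_kernel N \<omega> z1 z2 =
           \<i> * (LINT \<phi>:{0..2 * pi}|lebesgue.
             complex_of_real (\<phi> / (2 * pi)) *
             polya_P \<omega> (int N - 1) (z1 * cis \<phi>) *
             (euler (polya_Q \<omega> (N - 1)) (z2 * cis \<phi>)
               + of_nat (N - 1) * polya_Q \<omega> (N - 1) (z2 * cis \<phi>)))
           + (\<Sum>k<N. (z1 / z2) ^ k)))"
proof -
  define h where "h = (\<lambda>t. \<omega> (cis t))"
  have "\<omega> \<in> L1_sym_diff N" and prod: "Re (\<Prod>j<N. mellin \<omega> (int j)) > 0"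
    using assms(2) by (auto simp: cyclic_polya_weight_def)
  then obtain B where B: "negligible B" and hB: "csmooth B (N - 1) h"
    using times_differentiable_imp_csmooth[of "N - 1" \<omega>] by (auto simp: L1_sym_diff_def h_def)
  have nz: "mellin \<omega> (int k) \<noteq> 0" if "k < N" for k
  proof
    assume "mellin \<omega> (int k) = 0"
    then have "(\<Prod>j<N. mellin \<omega> (int j)) = 0" using that by (intro prod_zero) auto
    with prod show False by (simp only: zero_complex.sel less_irrefl)
  qed
  have hj: "csmooth B (j + (N - 1 - j)) h" if "j < N" for j using hB that by simp
  have Q: "polya_Q \<omega> j (cis t) = Q_angle h j t" if "j < N" "t \<notin> B" for j t
    using polya_Q_cis[OF B hj[OF that(1), unfolded h_def], of t] that(2) by (auto simp: exc_def h_def)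
  \<comment> \<open>Below the top index a derivative is left over, so the identity holds at every
    angle, also on \<open>B\<close>.\<close>
  have Q': "polya_Q \<omega> j (cis t) = Q_angle h j t" if "j < N - 1" for j t
  proof -
    have j: "j < N" "N - 1 - j \<noteq> 0" using that by auto
    then show ?thesis using polya_Q_cis[OF B hj[OF j(1), unfolded h_def], of t] by (simp add: exc_def h_def)
  qed

  interpret biorthogonal_system haar_angle "\<lambda>j t. polya_P \<omega> (int j) (cis t)" "Q_angle h" N
  proof -
    interpret prob_space haar_angle by (rule prob_space_haar_angle)
    show "biorthogonal_system haar_angle (\<lambda>j t. polya_P \<omega> (int j) (cis t)) (Q_angle h) N"
    proof
      fix i j assume ij: "i < N" "j < N"
      have "csmooth B j h" using csmooth_mono[OF hB, of j] ij by simp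
      then have "csmooth B 0 (Q_angle h j)" by (intro csmooth_Q_angle[OF B]) simp
      then have "integrable haar_angle (\<lambda>t. polya_P \<omega> (int i) (cis t) * Q_angle h j t)"
        using csmooth_integrable[OF csmooth_P_Q[OF B, of 0 "Q_angle h j" \<omega> i 1]] by simp
      then show "has_bochner_integral haar_angle (\<lambda>t. polya_P \<omega> (int i) (cis t) * Q_angle h j t) (if i = j then 1 else 0)"
        using biorthonormal[OF B nz ij(1), of j] \<open>csmooth B j h\<close> by (simp add: has_bochner_integral_iff h_def)
    qed
  qed
  have K: "polya_kernel N \<omega> (cis s) (cis t) = K s t" if "t \<notin> B" for s t
    unfolding polya_kernel_def K_def using Q that by (intro sum.cong) auto

  have K_eq: "K = (\<lambda>x y. \<Sum>j<N. polya_P \<omega> (int j) (cis x) * Q_angle (\<lambda>t. \<omega> (cis t)) j y)"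
    by (intro ext, subst K_def, simp add: h_def)

  have A: "correlation_kernel N (polya_density N \<omega>) (polya_kernel N \<omega>)"
    unfolding correlation_kernel_def
  proof
    fix k assume k: "k \<in> {1..N}"
    \<comment> \<open>Almost every configuration has no coordinate in \<open>B\<close>, both for the
      fixed points and for those integrated out.\<close>
    have ae: "AE \<theta> in PiM I (\<lambda>_. haar_angle). \<forall>i\<in>I. \<theta> i \<notin> B" if "finite I" for I :: "nat set"
      by (rule AE_finite_allI[OF that], rule AE_PiM_component)
         (auto intro: prob_space_haar_angle AE_haar_angle_notin B)
    show "AE \<theta> in PiM {..<k} (\<lambda>_. haar_angle).
        k_point_function N (polya_density N \<omega>) k (\<lambda>i. cis (\<theta> i)) =
        Determinant.det (Matrix.mat k k (\<lambda>(a, b). polya_kernel N \<omega> (cis (\<theta> a)) (cis (\<theta> b))))"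
    proof (rule eventually_mono[OF ae[of "{..<k}"]])
      fix \<theta> :: "nat \<Rightarrow> real" assume \<theta>: "\<forall>i\<in>{..<k}. \<theta> i \<notin> B"
      let ?w = "\<lambda>\<tau> i. if i < k then \<theta> i else \<tau> i"
      have "(LINT \<tau>|PiM {k..<N} (\<lambda>_. haar_angle). polya_density N \<omega> (\<lambda>i. cis (?w \<tau> i)))
          = (LINT \<tau>|PiM {k..<N} (\<lambda>_. haar_angle). det_kernel K N (?w \<tau>) / fact N)"
      proof (rule integral_cong_AE)
        show "(\<lambda>\<tau>. polya_density N \<omega> (\<lambda>i. cis (?w \<tau> i))) \<in> borel_measurable (PiM {k..<N} (\<lambda>_. haar_angle))"
        proof (rule polya_density_measurable[OF B hB[unfolded h_def]])
          fix i assume "i < N"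
          then show "(\<lambda>\<tau>. ?w \<tau> i) \<in> PiM {k..<N} (\<lambda>_. haar_angle) \<rightarrow>\<^sub>M haar_angle"
            by (cases "i < k") auto
        qed
        show "(\<lambda>\<tau>. det_kernel K N (?w \<tau>) / fact N) \<in> borel_measurable (PiM {k..<N} (\<lambda>_. haar_angle))"
          using integrable_det_kernel[of k N \<theta>] k by (intro borel_measurable_divide) auto
        show "AE \<tau> in PiM {k..<N} (\<lambda>_. haar_angle). polya_density N \<omega> (\<lambda>i. cis (?w \<tau> i)) = det_kernel K N (?w \<tau>) / fact N"
        proof (rule eventually_mono[OF ae[of "{k..<N}"]])
          fix \<tau> :: "nat \<Rightarrow> real" assume "\<forall>i\<in>{k..<N}. \<tau> i \<notin> B"
          then have "?w \<tau> i \<notin> B" if "i < N" for i using \<theta> that by auto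
          then show "polya_density N \<omega> (\<lambda>i. cis (?w \<tau> i)) = det_kernel K N (?w \<tau>) / fact N"
            unfolding K_eq by (intro polya_density_eq[OF B hB[unfolded h_def] nz])
        qed simp
      qed
      also have "\<dots> = fact (N - k) * det_kernel K k \<theta> / fact N"
        using integral_det_kernel_all[of k \<theta>] k by simp
      finally have "k_point_function N (polya_density N \<omega>) k (\<lambda>i. cis (\<theta> i)) = det_kernel K k \<theta>"
        unfolding k_point_function_def if_distrib[of cis, symmetric] by simp
      also have "\<dots> = Determinant.det (Matrix.mat k k (\<lambda>(a, b). polya_kernel N \<omega> (cis (\<theta> a)) (cis (\<theta> b))))"
        unfolding det_kernel_def using \<theta> by (intro arg_cong[where f = Determinant.det] eq_matI) (auto simp: K)
      finally show "k_point_function N (polya_density N \<omega>) k (\<lambda>i. cis (\<theta> i)) =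
        Determinant.det (Matrix.mat k k (\<lambda>(a, b). polya_kernel N \<omega> (cis (\<theta> a)) (cis (\<theta> b))))" .
    qed simp
  qed
  \<comment> \<open>No exception is made for \<alpha> in \<open>B\<close>: the summand with the top
    function is literally the same on both sides, and the lower ones are covered by
    \<open>Q'\<close>.\<close>
  have F1: "polya_kernel N \<omega> z (cis \<alpha>) =
         polya_P \<omega> (int N - 1) z * polya_Q \<omega> (N - 1) (cis \<alpha>)
         + \<i> * (LINT \<phi>:{0..2 * pi}|lebesgue.
             complex_of_real (\<phi> / (2 * pi)) *
             polya_P \<omega> (int N - 2) (z * cis \<phi>) * polya_Q \<omega> (N - 1) (cis \<alpha> * cis \<phi>))
         + (\<Sum>k<N - 1. (z / cis \<alpha>) ^ k)" if \<alpha>: "\<alpha> \<in> {0..<2*pi}" for z \<alpha>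
  proof -
    obtain m where m: "N = Suc m" using assms(1) by (cases N) auto
    have neg: "negligible {\<phi>. \<phi> + \<alpha> \<in> B}"
      by (rule negligible_translate_preimage[OF B])
    have "polya_kernel N \<omega> z (cis \<alpha>)
        = (\<Sum>j<m. polya_P \<omega> (int j) z * Q_angle h j \<alpha>) + polya_P \<omega> (int m) z * polya_Q \<omega> m (cis \<alpha>)"
      unfolding polya_kernel_def m using Q' m by simp
    also have "(\<Sum>j<m. polya_P \<omega> (int j) z * Q_angle h j \<alpha>) =
      \<i> * (LINT \<phi>:{0..2*pi}|lebesgue. of_real (\<phi> / (2*pi)) * polya_P \<omega> (int m - 1) (z * cis \<phi>) * Q_angle h m (\<phi> + \<alpha>))
      + (\<Sum>k<m. (z / cis \<alpha>) ^ k)"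
      unfolding h_def by (rule kernel_sum_eq[OF B]) (use hB nz m \<alpha> in \<open>auto simp: h_def\<close>)
    also have "(LINT \<phi>:{0..2*pi}|lebesgue. of_real (\<phi> / (2*pi)) * polya_P \<omega> (int m - 1) (z * cis \<phi>) * Q_angle h m (\<phi> + \<alpha>))
        = (LINT \<phi>:{0..2*pi}|lebesgue. of_real (\<phi> / (2*pi)) * polya_P \<omega> (int N - 2) (z * cis \<phi>) * polya_Q \<omega> m (cis \<alpha> * cis \<phi>))"
    \<comment> \<open>For \<open>m = 0\<close> both integrands vanish, as the polynomial has index
      -1. Otherwise they differ only where the rotated angle meets \<open>B\<close>.\<close>
    proof (cases m)
      case 0
      then show ?thesis by (simp add: polya_P_def m)
    next
      case (Suc l)
      let ?f = "\<lambda>\<phi>. of_real (\<phi> / (2*pi)) * (polya_P \<omega> (int l) (z * cis \<phi>) * Q_angle h m (\<phi> + \<alpha>))"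
      let ?g = "\<lambda>\<phi>. of_real (\<phi> / (2*pi)) * (polya_P \<omega> (int l) (z * cis \<phi>) * polya_Q \<omega> m (cis \<alpha> * cis \<phi>))"
      have "csmooth {\<phi>. \<phi> + \<alpha> \<in> B} 0 (\<lambda>\<phi>. Q_angle h m (\<phi> + \<alpha>))"
        by (rule csmooth_shift[OF _ _ csmooth_Q_angle[OF B]]) (use \<alpha> hB m in auto)
      then have "integrable haar_angle (\<lambda>\<phi>. polya_P \<omega> (int l) (z * cis \<phi>) * Q_angle h m (\<phi> + \<alpha>))"
        by (intro csmooth_integrable[OF csmooth_P_Q[OF neg]])
      then have i: "(\<lambda>\<phi>. polya_P \<omega> (int l) (z * cis \<phi>) * Q_angle h m (\<phi> + \<alpha>)) \<in> borel_measurable lebesgue"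
        by (simp add: integrable_haar_angle_iff)
      have f: "?f \<in> borel_measurable lebesgue"
        by (intro borel_measurable_times i continuous_imp_borel_measurable_lebesgue continuous_intros) simp
      have ae: "AE \<phi> in lebesgue. ?f \<phi> = ?g \<phi>"
        using AE_not_in[of "{\<phi>. \<phi> + \<alpha> \<in> B}" lebesgue] neg Q[of m] m
        by (auto simp: negligible_iff_null_sets cis_mult add.commute elim!: eventually_mono)
      have g: "?g \<in> borel_measurable lebesgue" by (rule borel_measurable_AE[OF f ae])
      have "(LINT \<phi>:{0..2*pi}|lebesgue. ?f \<phi>) = (LINT \<phi>:{0..2*pi}|lebesgue. ?g \<phi>)"
        unfolding set_lebesgue_integral_def
      proof (rule integral_cong_AE)
        show "(\<lambda>\<phi>. indicator {0..2*pi} \<phi> *\<^sub>R ?f \<phi>) \<in> borel_measurable lebesgue"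
          by (rule borel_measurable_scaleR[OF borel_measurable_indicator f]) simp
        show "(\<lambda>\<phi>. indicator {0..2*pi} \<phi> *\<^sub>R ?g \<phi>) \<in> borel_measurable lebesgue"
          by (rule borel_measurable_scaleR[OF borel_measurable_indicator g]) simp
        show "AE \<phi> in lebesgue. indicator {0..2*pi} \<phi> *\<^sub>R ?f \<phi> = indicator {0..2*pi} \<phi> *\<^sub>R ?g \<phi>"
          by (rule eventually_mono[OF ae]) simp
      qed
      then show ?thesis by (simp add: m Suc mult.assoc)
    qed
    finally show ?thesis by (simp add: m)
  qed
  have F2: "polya_kernel N \<omega> z (cis \<alpha>) =
           \<i> * (LINT \<phi>:{0..2 * pi}|lebesgue.
             complex_of_real (\<phi> / (2 * pi)) *
             polya_P \<omega> (int N - 1) (z * cis \<phi>) *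
             (euler (polya_Q \<omega> (N - 1)) (cis \<alpha> * cis \<phi>)
               + of_nat (N - 1) * polya_Q \<omega> (N - 1) (cis \<alpha> * cis \<phi>)))
           + (\<Sum>k<N. (z / cis \<alpha>) ^ k)"
    if reg: "times_differentiable N \<omega>" "\<forall>j\<le>N. deriv_in_L1 j \<omega>" and \<alpha>: "\<alpha> \<in> {0..<2*pi}" for z \<alpha>
  proof -
    obtain B' where B': "negligible B'" and hB': "csmooth B' N h"
      using times_differentiable_imp_csmooth[of N \<omega>] reg by (auto simp: h_def)
    obtain m where m: "N = Suc m" using assms(1) by (cases N) auto
    \<comment> \<open>The extra derivative makes this an identity of functions for every index below
      N, including the top one.\<close>
    have Q: "polya_Q \<omega> j (cis t) = Q_angle h j t" if "j < N" for j t
      using polya_Q_cis[OF B', of j "N - j" \<omega> t] hB' that by (auto simp: exc_def h_def)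
    \<comment> \<open>Equal functions have equal \<open>euler_angle\<close>, so this holds for every
      \<phi> even though the last derivative may fail to exist.\<close>
    have QN: "Q_angle h N (\<phi> + \<alpha>) = euler (polya_Q \<omega> (N - 1)) (cis \<alpha> * cis \<phi>)
               + of_nat (N - 1) * polya_Q \<omega> (N - 1) (cis \<alpha> * cis \<phi>)" for \<phi>
      unfolding cis_mult euler_cis using Q[of m] by (simp add: m euler_plus_def add.commute)
    have "polya_kernel N \<omega> z (cis \<alpha>) = (\<Sum>j<N. polya_P \<omega> (int j) z * Q_angle h j \<alpha>)"
      unfolding polya_kernel_def using Q by simp
    also have "\<dots> = \<i> * (LINT \<phi>:{0..2*pi}|lebesgue. of_real (\<phi> / (2*pi)) * polya_P \<omega> (int N - 1) (z * cis \<phi>) * Q_angle h N (\<phi> + \<alpha>))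
      + (\<Sum>k<N. (z / cis \<alpha>) ^ k)"
      unfolding h_def by (rule kernel_sum_eq[OF B']) (use hB' nz m \<alpha> in \<open>auto simp: h_def\<close>)
    finally show ?thesis by (simp only: QN)
  qed
  show ?thesis
  proof (intro conjI impI A, goal_cases)
    case 1
    \<comment> \<open>Almost every angle lies in one period, where translation by \<alpha> is
      available.\<close>
    show ?case
      by (intro eventually_mono[OF AE_haar_angle_ivl] ballI allI impI, erule ssubst, rule F1)
  next
    case 2
    then have reg: "times_differentiable N \<omega>" "\<forall>j\<le>N. deriv_in_L1 j \<omega>" by blast+
    show ?case
      by (intro eventually_mono[OF AE_haar_angle_ivl] ballI allI impI, erule ssubst, rule F2[OF reg])
  qed
qed

end
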